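(* Let $k\ge 1$ be an integer and let $\mu$ be a regular non-negative $k$-Carleson measure on the unit disk $\mathbb{D}$. Let $\mathbf{T}=\mathbf{T}_{k,k,\mu}$ be the Toeplitz operator on the Bergman space $\mathcal{A}^2(\mathbb{D})$ generated by the distribution $\Phi=\partial^k\bar\partial^k\mu$. If $$\int_{\mathbb{D}}(1-|w|^2)^{-2-2k}\,d\mu(w)<\infty,$$ then $\mathbf{T}$ belongs to the trace class, and $$\operatorname{tr}\mathbf{T}=\left(\Phi,\frac{1}{(1-|w|^2)^2}\right),$$ that is, $\operatorname{tr}\mathbf{T}=\int_{\mathbb{D}}\partial_w^k\partial_{\overline w}^k\left[(1-w\overline w)^{-2}\right]d\mu(w)$.
   Context: $\mathcal{A}^2(\mathbb{D})$ is the Bergman space: the closed subspace of $L_2(\mathbb{D},dA)$ consisting of functions analytic in the open unit disk $\mathbb{D}$, where $dA=\frac1\pi dx\,dy$. Its inner product $\langle\cdot,\cdot\rangle$ is linear in the first argument, and its reproducing kernel is $K_z(w)=(1-\overline z w)^{-2}$. Here $\partial=\partial_w$ and $\bar\partial=\partial_{\overline w}$ are the Wirtinger derivatives; on analytic functions $\partial$ is the complex derivative. A measure $\mu$ on $\mathbb{D}$ is called $k$-Carleson if there is a constant $C$ such that $\left|\int_{\mathbb{D}}|f^{(k)}(z)|^2\,d\mu(z)\right|\le C\|f\|^2_{\mathcal{A}^2(\mathbb{D})}$ for all $f\in\mathcal{A}^2(\mathbb{D})$. For nonnegative integers $\alpha,\beta$ define the sesquilinear form $$\mathbf{F}_{\alpha,\beta,\mu}[f,g]=(-1)^{\alpha+\beta}\int_{\mathbb{D}}\partial^\alpha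 f(z)\,\overline{\partial^\beta g(z)}\,d\mu(z),\qquad f,g\in\mathcal{A}^2(\mathbb{D}).$$ This is the form associated with the distribution $\partial^\alpha\bar\partial^\beta\mu$, namely $(\partial^\alpha\bar\partial^\beta\mu,f\overline g)$. The Toeplitz operator $\mathbf{T}_{\alpha,\beta,\mu}$ generated by $\partial^\alpha\bar\partial^\beta\mu$ is the operator $(\mathbf{T}f)(z)=\mathbf{F}_{\alpha,\beta,\mu}[f,K_z]$; equivalently, $\langle\mathbf{T}f,g\rangle=\mathbf{F}_{\alpha,\beta,\mu}[f,g]$ for all $f,g\in\mathcal{A}^2(\mathbb{D})$. For a smooth function $h$ on $\mathbb{D}$, the pairing is understood as $(\partial^\alpha\bar\partial^\beta\mu,h)=(-1)^{\alpha+\beta}\int_{\mathbb{D}}\partial^\alpha\bar\partial^\beta h\,d\mu$; the sign is $+1$ when $\alpha=\beta=k$. *)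

theory Defs
  imports "HOL-Analysis.Analysis"
begin

abbreviation unit_disk :: "complex set" where
  "unit_disk \<equiv> ball 0 1"

definition disk_area :: "complex measure" where
  "disk_area = scale_measure (ennreal (1 / pi)) (restrict_space lborel unit_disk)"

text \<open>
  A function on the disk is represented by its extension by zero, so that equality of functions
  is equality on the disk and the Bergman norm is a norm.
\<close>

definition bergman :: "(complex \<Rightarrow> complex) set" where
  "bergman = {f. f holomorphic_on unit_disk \<and> integrable disk_area (\<lambda>z. (cmod (f z))\<^sup>2) \<and>
     (\<forall>z. z \<notin> unit_disk \<longrightarrow> f z = 0)}"

definition bergman_inner :: "(complex \<Rightarrow> complex) \<Rightarrow> (complex \<Rightarrow> complex) \<Rightarrow> complex" where
  "bergman_inner f g = (LINT z|disk_area. f z * cnj (g z))"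

definition bergman_norm :: "(complex \<Rightarrow> complex) \<Rightarrow> real" where
  "bergman_norm f = sqrt (LINT z|disk_area. (cmod (f z))\<^sup>2)"

definition bergman_kernel :: "complex \<Rightarrow> complex \<Rightarrow> complex" where
  "bergman_kernel z = (\<lambda>w. if w \<in> unit_disk then 1 / (1 - cnj z * w)\<^sup>2 else 0)"

text \<open>
  Regularity in the usual sense: outer regularity by open sets and inner regularity by compact
  sets, for all Borel subsets of the disk. Finiteness on compact sets is not imposed; the Carleson
  condition, applied to the \<open>k\<close>-th power of the identity, already makes the measure finite.
\<close>

definition regular_on_disk :: "complex measure \<Rightarrow> bool" where
  "regular_on_disk \<mu> \<longleftrightarrow> sets \<mu> = sets (restrict_space borel unit_disk) \<and>
     (\<forall>B\<in>sets \<mu>.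
        emeasure \<mu> B = (INF U\<in>{U. B \<subseteq> U \<and> U \<subseteq> unit_disk \<and> open U}. emeasure \<mu> U) \<and>
        emeasure \<mu> B = (SUP K\<in>{K. K \<subseteq> B \<and> compact K}. emeasure \<mu> K))"

text \<open>
  The measures are non-negative, so the integral exists in \<open>[0, \<infinity>]\<close>, and its finiteness is part
  of the condition.
\<close>

definition carleson :: "nat \<Rightarrow> complex measure \<Rightarrow> bool" where
  "carleson k \<mu> \<longleftrightarrow> (\<exists>C::real. \<forall>f\<in>bergman.
     (\<integral>\<^sup>+ z. ennreal ((cmod ((deriv ^^ k) f z))\<^sup>2) \<partial>\<mu>) \<le> ennreal (C * (bergman_norm f)\<^sup>2))"

definition toeplitz_form ::
  "nat \<Rightarrow> nat \<Rightarrow> complex measure \<Rightarrow> (complex \<Rightarrow> complex) \<Rightarrow> (complex \<Rightarrow> complex) \<Rightarrow> complex" where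
  "toeplitz_form \<alpha> \<beta> \<mu> f g =
     (- 1) ^ (\<alpha> + \<beta>) * (LINT z|\<mu>. (deriv ^^ \<alpha>) f z * cnj ((deriv ^^ \<beta>) g z))"

definition toeplitz ::
  "nat \<Rightarrow> nat \<Rightarrow> complex measure \<Rightarrow> (complex \<Rightarrow> complex) \<Rightarrow> complex \<Rightarrow> complex" where
  "toeplitz \<alpha> \<beta> \<mu> f =
     (\<lambda>z. if z \<in> unit_disk then toeplitz_form \<alpha> \<beta> \<mu> f (bergman_kernel z) else 0)"

text \<open>The Wirtinger derivatives, with \<open>frechet_derivative h (at z)\<close> the real differential of \<open>h\<close>.\<close>

definition wirtinger :: "(complex \<Rightarrow> complex) \<Rightarrow> complex \<Rightarrow> complex" where
  "wirtinger h z =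
     (frechet_derivative h (at z) 1 - \<i> * frechet_derivative h (at z) \<i>) / 2"

definition wirtinger_bar :: "(complex \<Rightarrow> complex) \<Rightarrow> complex \<Rightarrow> complex" where
  "wirtinger_bar h z =
     (frechet_derivative h (at z) 1 + \<i> * frechet_derivative h (at z) \<i>) / 2"

definition distribution_pairing ::
  "nat \<Rightarrow> nat \<Rightarrow> complex measure \<Rightarrow> (complex \<Rightarrow> complex) \<Rightarrow> complex" where
  "distribution_pairing \<alpha> \<beta> \<mu> h =
     (- 1) ^ (\<alpha> + \<beta>) * (LINT w|\<mu>. (wirtinger ^^ \<alpha>) ((wirtinger_bar ^^ \<beta>) h) w)"

definition bergman_operator :: "((complex \<Rightarrow> complex) \<Rightarrow> complex \<Rightarrow> complex) \<Rightarrow> bool" where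
  "bergman_operator T \<longleftrightarrow>
     (\<forall>f\<in>bergman. T f \<in> bergman) \<and>
     (\<forall>f\<in>bergman. \<forall>g\<in>bergman. \<forall>a b.
        T (\<lambda>z. a * f z + b * g z) = (\<lambda>z. a * T f z + b * T g z)) \<and>
     (\<exists>C. \<forall>f\<in>bergman. bergman_norm (T f) \<le> C * bergman_norm f)"

text \<open>An orthonormal basis is an orthonormal set whose linear span is dense.\<close>

definition bergman_onb :: "(complex \<Rightarrow> complex) set \<Rightarrow> bool" where
  "bergman_onb E \<longleftrightarrow> E \<subseteq> bergman \<and>
     (\<forall>e\<in>E. \<forall>e'\<in>E. bergman_inner e e' = (if e = e' then 1 else 0)) \<and>
     (\<forall>f\<in>bergman. \<forall>\<epsilon>>0. \<exists>F c. finite F \<and> F \<subseteq> E \<and>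
        bergman_norm (\<lambda>z. f z - (\<Sum>e\<in>F. c e * e z)) < \<epsilon>)"

definition bergman_adjoint ::
  "((complex \<Rightarrow> complex) \<Rightarrow> complex \<Rightarrow> complex) \<Rightarrow>
   ((complex \<Rightarrow> complex) \<Rightarrow> complex \<Rightarrow> complex) \<Rightarrow> bool" where
  "bergman_adjoint S T \<longleftrightarrow> bergman_operator S \<and>
     (\<forall>f\<in>bergman. \<forall>g\<in>bergman. bergman_inner (T f) g = bergman_inner f (S g))"

text \<open>
  \<open>bergman_abs P T\<close> states that \<open>P\<close> is the absolute value of \<open>T\<close>, the positive square root of
  \<open>S T\<close>, where \<open>S\<close> is the adjoint of \<open>T\<close>.
\<close>

definition bergman_abs ::
  "((complex \<Rightarrow> complex) \<Rightarrow> complex \<Rightarrow> complex) \<Rightarrow>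
   ((complex \<Rightarrow> complex) \<Rightarrow> complex \<Rightarrow> complex) \<Rightarrow> bool" where
  "bergman_abs P T \<longleftrightarrow> bergman_operator P \<and>
     (\<forall>f\<in>bergman. bergman_inner (P f) f \<in> \<real> \<and> 0 \<le> Re (bergman_inner (P f) f)) \<and>
     (\<exists>S. bergman_adjoint S T \<and> (\<forall>f\<in>bergman. P (P f) = S (T f)))"

definition bergman_trace_class :: "((complex \<Rightarrow> complex) \<Rightarrow> complex \<Rightarrow> complex) \<Rightarrow> bool" where
  "bergman_trace_class T \<longleftrightarrow> bergman_operator T \<and>
     (\<exists>P. bergman_abs P T \<and>
        (\<forall>E. bergman_onb E \<longrightarrow> (\<lambda>e. bergman_inner (P e) e) summable_on E))"

text \<open>
  The trace is the common value of the diagonal sums over all orthonormal bases. Such bases exist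
  (the normalized monomials), so the description determines at most one value.
\<close>

definition bergman_trace :: "((complex \<Rightarrow> complex) \<Rightarrow> complex \<Rightarrow> complex) \<Rightarrow> complex" where
  "bergman_trace T = (THE t. \<forall>E. bergman_onb E \<longrightarrow> ((\<lambda>e. bergman_inner (T e) e) has_sum t) E)"

end

theory Submission
  imports Defs "HOL-Complex_Analysis.Cauchy_Integral_Formula"
begin

text \<open>
  Let \<open>K\<^sub>w\<close> be the element of the Bergman space representing the evaluation of the \<open>k\<close>-th derivative
  at \<open>w\<close>. Then \<open>T f\<close> is the superposition of the functions \<open>K\<^sub>w\<close> with the density
  \<open>f\<^sup>(\<^sup>k\<^sup>)(w)\<close> against \<open>\<mu>\<close>, so Fubini's theorem identifies \<open>\<langle>T f, g\<rangle>\<close> with the form. In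
  particular \<open>T\<close> is self-adjoint and positive, hence its own absolute value. By Parseval's identity,
  the sum over an orthonormal basis of \<open>\<langle>T e, e\<rangle>\<close>, which is the sum of the integrals of
  \<open>|\<langle>e, K\<^sub>w\<rangle>|\<^sup>2\<close>, equals the integral of \<open>\<parallel>K\<^sub>w\<parallel>\<^sup>2\<close>. Finally \<open>\<parallel>K\<^sub>w\<parallel>\<^sup>2\<close> is
  the \<open>k\<close>-th derivative of \<open>K\<^sub>w\<close> at \<open>w\<close>, which is the mixed Wirtinger derivative of
  \<open>(1 - |w|^2)^(-2)\<close> and is bounded by a constant times \<open>(1 - |w|^2)^(-2-2k)\<close>.
\<close>

text \<open>Every integrability claim about \<open>T\<close> goes back to one fact:
  \<open>(bergman_norm (K w))\<^sup>2\<close> is integrable in \<open>w\<close>. It makes the kernel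
  square integrable on the product of \<open>\<mu>\<close> and area, which legitimates Fubini, and
  its integral, the future trace, already bounds the operator norm. The squared norm is a
  holomorphic derivative evaluated on the diagonal, whereas the pairing asks for Wirtinger
  derivatives of a function of the modulus. Instead of comparing two unwieldy closed forms, both are
  traced to one family of sums of terms in \<open>z\<close>, \<open>v\<close> and
  \<open>inverse (1 - v * z)\<close> with independent \<open>z\<close> and \<open>v\<close>; the
  order of the pole then yields the exponent 2 + 2k of the weight. Exchanging the sum over an
  arbitrary basis with the integral requires that basis to be countable, and a trace given by a
  description over all bases requires one basis to pin down the value. Both needs are met by the
  monomials, whose inner products with \<open>f\<close> are its Taylor coefficients up to constants;
  this comes from rotation invariance of area, without polar coordinates.\<close>

section \<open>Products of square-integrable functions\<close>

lemma integrable_mult_of_square_integrable: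
  fixes f g :: "'a \<Rightarrow> complex"
  assumes [measurable]: "f \<in> borel_measurable M" "g \<in> borel_measurable M"
    and "integrable M (\<lambda>x. (cmod (f x))\<^sup>2)" "integrable M (\<lambda>x. (cmod (g x))\<^sup>2)"
  shows "integrable M (\<lambda>x. f x * g x)"
proof (rule Bochner_Integration.integrable_bound)
  show "integrable M (\<lambda>x. (cmod (f x))\<^sup>2 + (cmod (g x))\<^sup>2)"
    using assms by simp
  show "AE x in M. norm (f x * g x) \<le> norm ((cmod (f x))\<^sup>2 + (cmod (g x))\<^sup>2)"
  proof (rule AE_I2)
    fix x
    have "2 * norm (f x * g x) \<le> (cmod (f x))\<^sup>2 + (cmod (g x))\<^sup>2"
      using sum_squares_bound[of "cmod (f x)" "cmod (g x)"] by (simp add: norm_mult mult.assoc)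
    then show "norm (f x * g x) \<le> norm ((cmod (f x))\<^sup>2 + (cmod (g x))\<^sup>2)"
      using norm_ge_zero[of "f x * g x"] unfolding real_norm_def by linarith
  qed
qed simp

text \<open>The polynomial \<open>t\<^sup>2 * A - 2 * t * B + C\<close> is the integral of a square,
  hence non-negative for every real \<open>t\<close>.\<close>

lemma integral_Cauchy_Schwarz:
  fixes f g :: "'a \<Rightarrow> complex"
  assumes [measurable]: "f \<in> borel_measurable M" "g \<in> borel_measurable M"
    and f: "integrable M (\<lambda>x. (cmod (f x))\<^sup>2)" and g: "integrable M (\<lambda>x. (cmod (g x))\<^sup>2)"
  shows "(LINT x|M. cmod (f x * g x))\<^sup>2 \<le> (LINT x|M. (cmod (f x))\<^sup>2) * (LINT x|M. (cmod (g x))\<^sup>2)"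
proof -
  define A where "A = (LINT x|M. (cmod (f x))\<^sup>2)"
  define B where "B = (LINT x|M. cmod (f x * g x))"
  define C where "C = (LINT x|M. (cmod (g x))\<^sup>2)"
  have fg: "integrable M (\<lambda>x. cmod (f x * g x))"
    by (intro integrable_norm integrable_mult_of_square_integrable assms)
  have *: "0 \<le> t\<^sup>2 * A - 2 * t * B + C" for t
  proof -
    have "0 \<le> (LINT x|M. (t * cmod (f x) - cmod (g x))\<^sup>2)"
      by simp
    also have "(\<lambda>x. (t * cmod (f x) - cmod (g x))\<^sup>2)
        = (\<lambda>x. t\<^sup>2 * (cmod (f x))\<^sup>2 - 2 * t * cmod (f x * g x) + (cmod (g x))\<^sup>2)"
      by (simp add: fun_eq_iff power2_eq_square algebra_simps norm_mult)
    also have "(LINT x|M. t\<^sup>2 * (cmod (f x))\<^sup>2 - 2 * t * cmod (f x * g x) + (cmod (g x))\<^sup>2)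
        = t\<^sup>2 * A - 2 * t * B + C"
      using f g fg by (simp add: A_def B_def C_def)
    finally show ?thesis .
  qed
  have A0: "0 \<le> A" and C0: "0 \<le> C" and B0: "0 \<le> B"
    unfolding A_def B_def C_def by (simp_all add: integral_nonneg)
  have "B\<^sup>2 \<le> A * C"
  proof (cases "A = 0")
    case True
    have "B = 0"
    proof (rule ccontr)
      assume "B \<noteq> 0"
      with B0 have "B > 0" by simp
      \<comment> \<open>For \<open>A = 0\<close> the polynomial is linear in \<open>t\<close>; this
        choice of \<open>t\<close> gives it the value -1.\<close>
      then have "0 \<le> - 2 * ((C + 1) / (2 * B)) * B + C"
        using *[of "(C + 1) / (2 * B)"] True by simp
      with \<open>B > 0\<close> show False by (simp add: field_simps)
    qed
    with True show ?thesis by simp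
  next
    case False
    with A0 have "A > 0" by simp
    \<comment> \<open>The polynomial attains its minimum at \<open>t = B / A\<close>.\<close>
    with *[of "B / A"] show ?thesis
      by (simp add: power2_eq_square field_simps)
  qed
  then show ?thesis by (simp add: A_def B_def C_def)
qed

section \<open>Normalized area measure of the disk\<close>

lemma Complex_prod_Basis: "(\<Prod>b\<in>Basis. (v::complex) \<bullet> b) = Re v * Im v"
  by (simp add: Basis_complex_def inner_complex_def)

text \<open>Passes to \<open>real^2\<close>, where orthogonal maps are known to preserve measure.
  Lebesgue measure is determined by its values on boxes, and the coordinate map matches boxes with
  boxes.\<close>

lemma lborel_complex_eq_distr:
  "lborel = distr (lborel :: (real^2) measure) borel (\<lambda>v. Complex (v$1) (v$2))"
proof (rule lborel_eqI)
  let ?T = "\<lambda>v::real^2. Complex (v$1) (v$2)"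
  have T: "?T \<in> borel_measurable borel"
    by (intro borel_measurable_continuous_onI continuous_intros)
  fix l u :: complex assume le: "\<And>b. b \<in> Basis \<Longrightarrow> l \<bullet> b \<le> u \<bullet> b"
  define lv :: "real^2" where "lv = vector [Re l, Im l]"
  define uv :: "real^2" where "uv = vector [Re u, Im u]"
  have v: "?T -` box l u = box lv uv"
    by (auto simp: box_def Basis_complex_def inner_complex_def Basis_vec_def inner_axis UNIV_2
        lv_def uv_def)
  have B: "(Basis :: (real^2) set) = {axis 1 1, axis 2 1}"
    by (auto simp: Basis_vec_def UNIV_2)
  have neq: "axis 1 1 \<noteq> (axis 2 1 :: real^2)"
    by (simp add: axis_eq_axis)
  have "emeasure (distr lborel borel ?T) (box l u) = emeasure lborel (box lv uv)"
    using T by (simp add: emeasure_distr v)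
  also have "\<dots> = (\<Prod>b\<in>Basis. (uv - lv) \<bullet> b)"
    using le[of 1] le[of \<i>] by (intro emeasure_lborel_box)
      (auto simp: B inner_axis lv_def uv_def Basis_complex_def inner_complex_def)
  also have "\<dots> = (\<Prod>b\<in>Basis. (u - l) \<bullet> b)"
    unfolding Complex_prod_Basis using neq by (simp add: B inner_axis lv_def uv_def)
  finally show "emeasure (distr lborel borel ?T) (box l u) = (\<Prod>b\<in>Basis. (u - l) \<bullet> b)" .
qed simp

lemma lborel_complex_rotation:
  assumes c: "cmod c = 1"
  shows "distr lborel borel (\<lambda>z. c * z) = lborel"
proof (rule lborel_eqI [symmetric])
  define T where "T = (\<lambda>v::real^2. Complex (v$1) (v$2))"
  \<comment> \<open>Multiplication by \<open>cnj c\<close>, the inverse rotation, read in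
    \<open>real^2\<close>: the preimage of a box under the rotation becomes an image under
    \<open>R\<close>, and invariance is a statement about images.\<close>
  define R where "R = (\<lambda>v::real^2. (vector [Re (cnj c * T v), Im (cnj c * T v)] :: real^2))"
  have T: "T \<in> borel_measurable borel"
    unfolding T_def Complex_eq by (intro borel_measurable_continuous_onI continuous_intros)
  fix l u :: complex assume le: "\<And>b. b \<in> Basis \<Longrightarrow> l \<bullet> b \<le> u \<bullet> b"
  have cc: "c * cnj c = 1" using c by (simp add: complex_norm_square [symmetric])
  have lin: "linear R"
    by (rule linearI) (auto simp: R_def T_def vec_eq_iff forall_2 algebra_simps)
  have "orthogonal_transformation R"
    unfolding orthogonal_transformation
  proof (intro conjI allI lin)
    fix v :: "real^2"
    have "(norm (R v))\<^sup>2 = (cmod (cnj c * T v))\<^sup>2"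
      unfolding R_def by (simp only: power2_norm_eq_inner)
         (simp add: inner_vec_def sum_2 inner_complex_def)
    also have "\<dots> = (norm v)\<^sup>2"
      unfolding norm_mult using c
      by (simp add: T_def cmod_power2) (simp only: power2_norm_eq_inner, simp add: inner_vec_def sum_2 power2_eq_square)
    finally show "norm (R v) = norm v" by simp
  qed
  have TR: "T (R v) = cnj c * T v" for v
    by (simp add: T_def R_def complex_eq_iff)
  have TE: "emeasure lborel (T -` X) = emeasure lborel X" if "X \<in> sets borel" for X
    using arg_cong[OF lborel_complex_eq_distr, of "\<lambda>M. emeasure M X"] T that
    by (simp add: T_def[symmetric] emeasure_distr)
  let ?B = "T -` box l u"
  have Bs: "?B \<in> sets borel" using T by (metis box_borel measurable_sets_borel)
  have bd: "emeasure lborel ?B = emeasure lborel (box l u)"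
    by (rule TE) simp
  have fm: "?B \<in> lmeasurable"
    using bd Bs by (auto simp: fmeasurable_def simp: emeasure_bounded_finite[simplified])
  have inj: "T v = T w \<Longrightarrow> v = w" for v w
    by (simp add: T_def vec_eq_iff forall_2)
  have img: "R ` ?B = {v. c * T v \<in> box l u}"
  proof safe
    fix v assume "T v \<in> box l u"
    then show "c * T (R v) \<in> box l u" using cc by (simp add: TR flip: mult.assoc)
  next
    fix v assume v: "c * T v \<in> box l u"
    define w :: "real^2" where "w = vector [Re (c * T v), Im (c * T v)]"
    have Tw: "T w = c * T v" by (simp add: w_def T_def complex_eq_iff)
    have "T (R w) = T v" using cc by (simp add: TR Tw mult.commute flip: mult.assoc)
    then have "R w = v" by (rule inj)
    moreover have "w \<in> ?B" using v by (simp add: Tw)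
    ultimately show "v \<in> R ` ?B" by blast
  qed
  have mc: "(\<lambda>z. c * z) \<in> borel_measurable borel" by simp
  have "emeasure (distr lborel borel (\<lambda>z. c * z)) (box l u) = emeasure lborel ((\<lambda>z. c * z) -` box l u)"
    by (simp add: emeasure_distr)
  also have "\<dots> = emeasure lborel (T -` ((\<lambda>z. c * z) -` box l u))"
    using measurable_sets_borel[OF mc, of "box l u"] by (simp add: TE)
  also have "T -` ((\<lambda>z. c * z) -` box l u) = R ` ?B"
    by (auto simp: img)
  also have "emeasure lborel (R ` ?B) = emeasure lebesgue (R ` ?B)"
  proof -
    have "{v. c * T v \<in> box l u} = (\<lambda>v. c * T v) -` box l u" by auto
    also have "\<dots> \<in> sets borel"
      using T by (intro measurable_sets_borel[of _ borel]) auto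
    finally show ?thesis unfolding img by simp
  qed
  also have "\<dots> = emeasure lebesgue ?B"
    using measure_orthogonal_image[OF \<open>orthogonal_transformation R\<close> fm]
      measurable_orthogonal_image[OF \<open>orthogonal_transformation R\<close> fm] fm
    by (simp add: emeasure_eq_measure2)
  also have "\<dots> = emeasure lborel ?B" using Bs by simp
  also have "\<dots> = (\<Prod>b\<in>Basis. (u - l) \<bullet> b)"
    unfolding bd using le by (intro emeasure_lborel_box)
  finally show "emeasure (distr lborel borel (\<lambda>z. c * z)) (box l u) = (\<Prod>b\<in>Basis. (u - l) \<bullet> b)" .
qed simp

section \<open>Area of disks and rotations of the unit disk\<close>

lemma space_disk_area [simp]: "space disk_area = unit_disk"
  by (simp add: disk_area_def space_scale_measure space_restrict_space)

lemma sets_disk_area [measurable_cong]: "sets disk_area = sets (restrict_space borel unit_disk)"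
  unfolding disk_area_def by (simp add: sets_restrict_space)

lemma emeasure_disk_area:
  assumes "A \<in> sets borel"
  shows "emeasure disk_area (A \<inter> unit_disk) = ennreal (1 / pi) * emeasure lborel (A \<inter> unit_disk)"
  unfolding disk_area_def by (simp add: emeasure_restrict_space)

lemma emeasure_disk_area_ball:
  assumes "0 \<le> r" "r \<le> 1"
  shows "emeasure disk_area (ball 0 r) = ennreal (r\<^sup>2)"
proof -
  have "ball 0 r = ball (0::complex) r \<inter> unit_disk" using assms by auto
  then have "emeasure disk_area (ball 0 r) = ennreal (1 / pi) * emeasure lborel (ball (0::complex) r)"
    using emeasure_disk_area[of "ball 0 r"] by simp
  also have "\<dots> = ennreal (r\<^sup>2)"
    using assms by (subst emeasure_ball) (auto simp: unit_ball_vol_2 simp flip: ennreal_mult)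
  finally show ?thesis .
qed

lemma emeasure_disk_area_cball:
  assumes "0 \<le> r" "r < 1"
  shows "emeasure disk_area (cball 0 r) = ennreal (r\<^sup>2)"
proof -
  have "cball 0 r = cball (0::complex) r \<inter> unit_disk" using assms by auto
  then have "emeasure disk_area (cball 0 r) = ennreal (1 / pi) * emeasure lborel (cball (0::complex) r)"
    using emeasure_disk_area[of "cball 0 r"] by simp
  also have "\<dots> = ennreal (r\<^sup>2)"
    using assms by (subst emeasure_cball) (auto simp: unit_ball_vol_2 simp flip: ennreal_mult)
  finally show ?thesis .
qed

lemma emeasure_disk_area_space: "emeasure disk_area unit_disk = 1"
  using emeasure_disk_area_ball[of 1] by simp

interpretation disk_area: finite_measure disk_area
  by (rule finite_measureI) (simp add: emeasure_disk_area_space)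

lemma borel_measurable_disk_area:
  "f \<in> borel_measurable borel \<Longrightarrow> f \<in> borel_measurable disk_area"
  by (simp add: measurable_cong_sets[OF sets_disk_area refl] measurable_restrict_space1)

lemma borel_measurable_continuous_on_disk:
  fixes f :: "complex \<Rightarrow> 'a::topological_space"
  shows "sets M = sets (restrict_space borel unit_disk) \<Longrightarrow> continuous_on unit_disk f \<Longrightarrow>
    f \<in> borel_measurable M"
  by (subst measurable_cong_sets[of M "restrict_space borel unit_disk" borel borel])
     (auto intro: borel_measurable_continuous_on_restrict)

lemma disk_area_rotation:
  assumes c: "cmod c = 1"
  shows "distr disk_area disk_area (\<lambda>z. c * z) = disk_area"
proof (rule measure_eqI)
  have m [measurable]: "(\<lambda>z. c * z) \<in> measurable disk_area disk_area"
    unfolding measurable_cong_sets[OF sets_disk_area sets_disk_area]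
    by (intro measurable_restrict_space2 measurable_restrict_space1)
       (auto simp: space_restrict_space norm_mult c)
  fix A assume "A \<in> sets (distr disk_area disk_area (\<lambda>z. c * z))"
  then have Ad: "A \<in> sets disk_area" by simp
  then have A: "A \<in> sets borel" "A \<subseteq> unit_disk"
    by (auto simp: sets_disk_area sets_restrict_space)
  have A': "(\<lambda>z. c * z) -` A \<in> sets borel"
    by (rule measurable_sets_borel[OF _ A(1)]) simp
  have "emeasure (distr disk_area disk_area (\<lambda>z. c * z)) A
      = emeasure disk_area ((\<lambda>z. c * z) -` A \<inter> unit_disk)"
    using m Ad by (simp add: emeasure_distr)
  also have "\<dots> = ennreal (1 / pi) * emeasure lborel ((\<lambda>z. c * z) -` A \<inter> unit_disk)"
    by (rule emeasure_disk_area) fact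
  also have "(\<lambda>z. c * z) -` A \<inter> unit_disk = (\<lambda>z. c * z) -` A"
  proof -
    have "cmod x < 1" if "c * x \<in> A" for x
      using A(2) that c by (auto simp: norm_mult dest!: subsetD[of A _ "c * x"])
    then show ?thesis by auto
  qed
  also have "emeasure lborel ((\<lambda>z. c * z) -` A) = emeasure (distr lborel borel (\<lambda>z. c * z)) A"
    using A by (subst emeasure_distr) auto
  also have "\<dots> = emeasure lborel A"
    by (simp add: lborel_complex_rotation[OF c])
  also have "ennreal (1 / pi) * emeasure lborel A = emeasure disk_area A"
    using emeasure_disk_area[OF A(1)] A(2) by (simp add: Int_absorb2)
  finally show "emeasure (distr disk_area disk_area (\<lambda>z. c * z)) A = emeasure disk_area A" .
qed simp

lemma integral_disk_area_rotation:
  fixes f :: "complex \<Rightarrow> complex"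
  assumes c: "cmod c = 1" and f: "f \<in> borel_measurable borel"
  shows "(LINT z|disk_area. f (c * z)) = (LINT z|disk_area. f z)"
proof -
  have m: "(\<lambda>z. c * z) \<in> measurable disk_area disk_area"
    unfolding measurable_cong_sets[OF sets_disk_area sets_disk_area]
    by (intro measurable_restrict_space2 measurable_restrict_space1)
       (auto simp: space_restrict_space norm_mult c)
  have "(LINT z|disk_area. f z) = (LINT z|distr disk_area disk_area (\<lambda>z. c * z). f z)"
    by (simp add: disk_area_rotation[OF c])
  also have "\<dots> = (LINT z|disk_area. f (c * z))"
    using m borel_measurable_disk_area[OF f] by (rule integral_distr)
  finally show ?thesis ..
qed

section \<open>Moments of the disk\<close>

text \<open>A suitable rotation preserves the integral but changes the sign of the integrand, so the
  integral is its own negative. The indicator is rotation invariant as well; it is carried along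
  because Taylor series are first integrated over smaller disks.\<close>

lemma monomials_orthogonal:
  assumes "m \<noteq> n"
  shows "(LINT z|disk_area. indicator (ball 0 r) z *\<^sub>R (z ^ m * cnj z ^ n)) = 0"
proof -
  \<comment> \<open>The angle that makes \<open>c ^ m * cnj c ^ n\<close> equal to
    \<open>cis pi\<close>, that is -1.\<close>
  define t where "t = pi / (real m - real n)"
  define c where "c = cis t"
  define f :: "complex \<Rightarrow> complex" where
    "f = (\<lambda>z. indicator (ball 0 r) z *\<^sub>R (z ^ m * cnj z ^ n))"
  have c: "cmod c = 1" by (simp add: c_def)
  have f: "f \<in> borel_measurable borel"
    unfolding f_def by (intro borel_measurable_scaleR borel_measurable_indicator
        borel_measurable_continuous_onI continuous_intros) auto
  have "real m * t - real n * t = pi"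
    using assms unfolding t_def left_diff_distrib [symmetric] by simp
  then have "c ^ m * cnj c ^ n = - 1"
    by (simp add: c_def Complex.DeMoivre cis_cnj cis_mult)
  moreover have "f (c * z) = (c ^ m * cnj c ^ n) * f z" for z
    using c by (auto simp: f_def norm_mult power_mult_distrib indicator_def)
  ultimately have "f (c * z) = - f z" for z by simp
  then have "(LINT z|disk_area. - f z) = (LINT z|disk_area. f z)"
    using integral_disk_area_rotation[OF c f] by simp
  then show ?thesis by (simp add: f_def)
qed

text \<open>The disk of radius \<open>r\<close> has normalized area \<open>r\<^sup>2\<close>, so the
  squared modulus is uniformly distributed on [0,1] and radial integrals reduce to integrals over an
  interval. The three cases are a half-line that contains, cuts or misses [0,1].\<close>

lemma distr_disk_area_norm_square:
  "distr disk_area borel (\<lambda>z. (cmod z)\<^sup>2) = density lborel (\<lambda>x. ennreal (indicator {0..1} x))"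
proof (rule measure_eqI_lessThan)
  have m: "(\<lambda>z. (cmod z)\<^sup>2) \<in> borel_measurable disk_area"
    by (intro borel_measurable_disk_area) measurable
  fix x :: real
  have D: "emeasure (distr disk_area borel (\<lambda>z. (cmod z)\<^sup>2)) {x<..}
      = emeasure disk_area {z \<in> unit_disk. x < (cmod z)\<^sup>2}"
    using m by (simp add: emeasure_distr vimage_def Int_def conj_commute)
  also have "\<dots> \<le> emeasure disk_area unit_disk"
    by (rule emeasure_mono) (auto simp: sets_disk_area sets_restrict_space)
  also have "\<dots> < \<infinity>" by (simp add: emeasure_disk_area_space)
  finally show "emeasure (distr disk_area borel (\<lambda>z. (cmod z)\<^sup>2)) {x<..} < \<infinity>" .
  have U: "emeasure (density lborel (\<lambda>x. ennreal (indicator {0..1} x))) {x<..}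
      = emeasure lborel ({0..1} \<inter> {x<..})"
  proof -
    have "(\<integral>\<^sup>+ y. ennreal (indicator {0..1} y) * indicator {x<..} y \<partial>lborel)
        = (\<integral>\<^sup>+ y. indicator ({0..1} \<inter> {x<..}) y \<partial>lborel)"
      by (intro nn_integral_cong) (auto split: split_indicator)
    then show ?thesis by (simp add: emeasure_density)
  qed
  consider "x < 0" | "0 \<le> x" "x < 1" | "1 \<le> x" by linarith
  then show "emeasure (distr disk_area borel (\<lambda>z. (cmod z)\<^sup>2)) {x<..}
      = emeasure (density lborel (\<lambda>x. ennreal (indicator {0..1} x))) {x<..}"
  proof cases
    case 1
    then have "{z \<in> unit_disk. x < (cmod z)\<^sup>2} = unit_disk" "{0..1} \<inter> {x<..} = {0..1}"
      by (auto intro!: less_le_trans[of x 0])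
    then show ?thesis unfolding D U by (simp add: emeasure_disk_area_space)
  next
    case 2
    have "{z \<in> unit_disk. x < (cmod z)\<^sup>2} = unit_disk - cball 0 (sqrt x)"
    proof -
      have "x < (cmod z)\<^sup>2 \<longleftrightarrow> sqrt x < cmod z" for z
        using real_sqrt_less_iff[of x "(cmod z)\<^sup>2"] by (simp del: real_sqrt_less_iff)
      then show ?thesis by (simp only: set_eq_iff mem_Collect_eq Diff_iff mem_cball_0 not_le) blast
    qed
    moreover have "sqrt x < 1" using 2 by simp
    moreover have "cball 0 (sqrt x) \<subseteq> unit_disk"
      using \<open>sqrt x < 1\<close> by (auto intro: le_less_trans simp del: real_sqrt_lt_1_iff)
    moreover have "cball 0 (sqrt x) \<in> sets disk_area" "unit_disk \<in> sets disk_area"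
      using \<open>cball 0 (sqrt x) \<subseteq> unit_disk\<close>
      by (simp_all add: sets_disk_area sets_restrict_space_iff)
    ultimately have "emeasure disk_area {z \<in> unit_disk. x < (cmod z)\<^sup>2} = 1 - ennreal x"
      using 2 emeasure_Diff[of disk_area "cball 0 (sqrt x)" unit_disk]
      by (simp add: emeasure_disk_area_cball emeasure_disk_area_space)
    moreover have "{0..1} \<inter> {x<..} = {x<..1}" using 2 by auto
    moreover have "1 - ennreal x = ennreal (1 - x)"
      using 2 ennreal_minus[of x 1] by simp
    ultimately show ?thesis unfolding D U using 2 by simp
  next
    case 3
    have "{z \<in> unit_disk. x < (cmod z)\<^sup>2} = {}"
    proof -
      have "\<not> x < (cmod z)\<^sup>2" if "z \<in> unit_disk" for z
        using 3 that power_le_one[of "cmod z" 2] by (auto simp: not_less)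
      then show ?thesis by auto
    qed
    moreover have "{0..1} \<inter> {x<..} = {}" using 3 by auto
    ultimately show ?thesis unfolding D U by (simp only: emeasure_empty)
  qed
qed simp_all

text \<open>These are the squared norms of the monomials, the origin of the factor
  \<open>n + 1\<close> in the coefficient formulas.\<close>

lemma integral_norm_power_disk_area:
  "(LINT z|disk_area. cmod z ^ (2 * n)) = 1 / (real n + 1)"
proof -
  have "(LINT z|disk_area. cmod z ^ (2 * n)) = (LINT z|disk_area. ((cmod z)\<^sup>2) ^ n)"
    by (simp add: power_mult)
  also have "\<dots> = (LINT x|distr disk_area borel (\<lambda>z. (cmod z)\<^sup>2). x ^ n)"
    by (rule integral_distr [symmetric]) (auto intro: borel_measurable_disk_area)
  also have "\<dots> = (LINT x|lborel. indicator {0..1} x *\<^sub>R x ^ n)"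
    unfolding distr_disk_area_norm_square by (rule integral_density) auto
  also have "\<dots> = 1 / (real n + 1)"
    using integral_power[of 0 1 n] by (simp add: mult.commute add.commute)
  finally show ?thesis .
qed

section \<open>Bergman space and reproducing kernels\<close>

lemma borel_measurable_cnj [measurable (raw)]:
  "f \<in> borel_measurable M \<Longrightarrow> (\<lambda>x. cnj (f x)) \<in> borel_measurable M"
  by (rule measurable_compose[where g = cnj])
     (auto intro: borel_measurable_continuous_onI continuous_intros)

lemma bergmanD:
  assumes "f \<in> bergman"
  shows "f holomorphic_on unit_disk" "integrable disk_area (\<lambda>z. (cmod (f z))\<^sup>2)"
    "\<And>z. z \<notin> unit_disk \<Longrightarrow> f z = 0" "f \<in> borel_measurable disk_area"
  using assms
  by (auto simp: bergman_def
      intro!: borel_measurable_continuous_on_disk sets_disk_area holomorphic_on_imp_continuous_on)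

lemma bergman_integrable_inner:
  assumes "f \<in> bergman" "g \<in> bergman"
  shows "integrable disk_area (\<lambda>z. f z * cnj (g z))"
  using bergmanD[OF assms(1)] bergmanD[OF assms(2)]
  by (intro integrable_mult_of_square_integrable) auto

lemma bergman_lincomb:
  assumes f: "f \<in> bergman" and g: "g \<in> bergman"
  shows "(\<lambda>z. a * f z + b * g z) \<in> bergman"
proof -
  note [measurable] = bergmanD(4)[OF f] bergmanD(4)[OF g]
  have "integrable disk_area (\<lambda>z. (cmod (a * f z + b * g z))\<^sup>2)"
  proof (rule Bochner_Integration.integrable_bound)
    show "integrable disk_area
        (\<lambda>z. 2 * (cmod a)\<^sup>2 * (cmod (f z))\<^sup>2 + 2 * (cmod b)\<^sup>2 * (cmod (g z))\<^sup>2)"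
      using bergmanD(2)[OF f] bergmanD(2)[OF g] by simp
    show "AE z in disk_area. norm ((cmod (a * f z + b * g z))\<^sup>2)
        \<le> norm (2 * (cmod a)\<^sup>2 * (cmod (f z))\<^sup>2 + 2 * (cmod b)\<^sup>2 * (cmod (g z))\<^sup>2)"
    proof (rule AE_I2)
      fix z
      have "(cmod (a * f z + b * g z))\<^sup>2 \<le> (cmod (a * f z) + cmod (b * g z))\<^sup>2"
        by (intro power_mono norm_triangle_ineq norm_ge_zero)
      also have "\<dots> \<le> 2 * (cmod (a * f z))\<^sup>2 + 2 * (cmod (b * g z))\<^sup>2"
        using sum_squares_bound[of "cmod (a * f z)" "cmod (b * g z)"] by (simp add: power2_sum)
      finally show "norm ((cmod (a * f z + b * g z))\<^sup>2)
        \<le> norm (2 * (cmod a)\<^sup>2 * (cmod (f z))\<^sup>2 + 2 * (cmod b)\<^sup>2 * (cmod (g z))\<^sup>2)"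
        by (simp add: norm_mult power_mult_distrib)
    qed
  qed simp
  then show ?thesis
    using bergmanD(1,3)[OF f] bergmanD(1,3)[OF g]
    by (auto simp: bergman_def intro!: holomorphic_intros)
qed

lemma bergman_scale: "f \<in> bergman \<Longrightarrow> (\<lambda>z. a * f z) \<in> bergman"
  using bergman_lincomb[of f f a 0] by simp

lemma bergman_diff: "f \<in> bergman \<Longrightarrow> g \<in> bergman \<Longrightarrow> (\<lambda>z. f z - g z) \<in> bergman"
  using bergman_lincomb[of f g 1 "-1"] by simp

lemma bergman_sum:
  assumes "finite F" "\<And>e. e \<in> F \<Longrightarrow> h e \<in> bergman"
  shows "(\<lambda>z. \<Sum>e\<in>F. c e * h e z) \<in> bergman"
  using assms
proof (induction F)
  case empty
  show ?case by (simp add: bergman_def)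
next
  case (insert e F)
  have "(\<lambda>z. c e * h e z + 1 * (\<Sum>e\<in>F. c e * h e z)) \<in> bergman"
    using insert by (intro bergman_lincomb) auto
  then show ?case using insert by simp
qed

lemma bergman_inner_cnj: "cnj (bergman_inner f g) = bergman_inner g f"
  unfolding bergman_inner_def by (simp add: mult.commute flip: Bochner_Integration.integral_cnj)

lemma bergman_inner_lincomb_left:
  assumes "f \<in> bergman" "g \<in> bergman" "h \<in> bergman"
  shows "bergman_inner (\<lambda>z. a * f z + b * g z) h = a * bergman_inner f h + b * bergman_inner g h"
  using bergman_integrable_inner[OF assms(1,3)] bergman_integrable_inner[OF assms(2,3)]
  unfolding bergman_inner_def by (simp add: distrib_right mult.assoc)

lemma bergman_inner_diff_left:
  assumes "f \<in> bergman" "g \<in> bergman" "h \<in> bergman"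
  shows "bergman_inner (\<lambda>z. f z - g z) h = bergman_inner f h - bergman_inner g h"
  using bergman_inner_lincomb_left[OF assms, of 1 "-1"] by simp

lemma bergman_inner_sum_left:
  assumes "finite F" "\<And>e. e \<in> F \<Longrightarrow> h e \<in> bergman" "g \<in> bergman"
  shows "bergman_inner (\<lambda>z. \<Sum>e\<in>F. c e * h e z) g = (\<Sum>e\<in>F. c e * bergman_inner (h e) g)"
  using assms(1,2)
proof (induction F)
  case empty
  show ?case by (simp add: bergman_inner_def)
next
  case (insert e F)
  have "bergman_inner (\<lambda>z. c e * h e z + 1 * (\<Sum>e\<in>F. c e * h e z)) g
      = c e * bergman_inner (h e) g + 1 * bergman_inner (\<lambda>z. \<Sum>e\<in>F. c e * h e z) g"
    using insert assms(3) by (intro bergman_inner_lincomb_left bergman_sum) auto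
  then show ?case using insert by simp
qed

lemma bergman_inner_self: "bergman_inner f f = complex_of_real ((bergman_norm f)\<^sup>2)"
  by (simp add: bergman_inner_def bergman_norm_def complex_norm_square [symmetric] integral_nonneg
      del: of_real_power)

lemma bergman_norm_square: "(bergman_norm f)\<^sup>2 = (LINT z|disk_area. (cmod (f z))\<^sup>2)"
  by (simp add: bergman_norm_def integral_nonneg)

lemma bergman_norm_nonneg: "0 \<le> bergman_norm f"
  by (simp add: bergman_norm_def integral_nonneg)

text \<open>The modulus stands inside the integral because the later use of Fubini for the inner
  product of \<open>T f\<close> with \<open>g\<close> needs absolute integrability.\<close>

lemma bergman_Cauchy_Schwarz_integral:
  assumes "f \<in> bergman" "g \<in> bergman"
  shows "(LINT z|disk_area. cmod (f z * cnj (g z))) \<le> bergman_norm f * bergman_norm g"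
proof (rule power2_le_imp_le)
  show "(LINT z|disk_area. cmod (f z * cnj (g z)))\<^sup>2 \<le> (bergman_norm f * bergman_norm g)\<^sup>2"
    using integral_Cauchy_Schwarz[of f disk_area "\<lambda>z. cnj (g z)"] bergmanD[OF assms(1)]
      bergmanD[OF assms(2)]
    by (simp add: power_mult_distrib bergman_norm_square)
qed (simp add: bergman_norm_nonneg)

lemma bergman_Cauchy_Schwarz:
  assumes "f \<in> bergman" "g \<in> bergman"
  shows "cmod (bergman_inner f g) \<le> bergman_norm f * bergman_norm g"
  using integral_norm_bound[of disk_area "\<lambda>z. f z * cnj (g z)"]
    bergman_Cauchy_Schwarz_integral[OF assms]
  unfolding bergman_inner_def by linarith

section \<open>Taylor coefficients as inner products\<close>

lemma sums_higher_deriv: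
  assumes f: "f holomorphic_on unit_disk" and z: "z \<in> unit_disk"
  shows "(\<lambda>m. (deriv ^^ (j + m)) f 0 / fact m * z ^ m) sums (deriv ^^ j) f z"
proof -
  have "(\<lambda>m. (deriv ^^ m) ((deriv ^^ j) f) 0 / fact m * (z - 0) ^ m) sums (deriv ^^ j) f z"
    by (rule holomorphic_power_series[OF _ z]) (intro holomorphic_higher_deriv f open_ball)
  then show ?thesis by (simp add: funpow_add add.commute)
qed

lemma power_mult_cnj_power: "z ^ n * cnj z ^ n = complex_of_real (cmod z ^ (2 * n))"
  unfolding power_mult_distrib [symmetric] complex_norm_square [symmetric] by (simp add: power_mult)

text \<open>On a smaller disk the Taylor series has a summable majorant and may be integrated term
  by term; orthogonality leaves only the term of index \<open>n\<close>. A general \<open>f\<close>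
  has no such majorant on the whole disk, hence the truncation.\<close>

lemma integral_truncated_monomial:
  assumes f: "f holomorphic_on unit_disk" and r: "0 < r" "r < 1"
  shows "(LINT z|disk_area. indicator (ball 0 r) z *\<^sub>R (f z * cnj z ^ n))
    = (deriv ^^ n) f 0 / fact n
      * of_real (LINT z|disk_area. indicator (ball 0 r) z * cmod z ^ (2 * n))"
proof -
  define a where "a = (\<lambda>i. (deriv ^^ i) f 0 / fact i)"
  define F :: "nat \<Rightarrow> complex \<Rightarrow> complex" where
    "F = (\<lambda>i z. indicator (ball 0 r) z *\<^sub>R (a i * (z ^ i * cnj z ^ n)))"
  have sf: "(\<lambda>i. a i * z ^ i) sums f z" if "z \<in> unit_disk" for z
    using sums_higher_deriv[OF f that, of 0] by (simp add: a_def)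
  \<comment> \<open>The midpoint between \<open>r\<close> and 1 is still in the disk; convergence
    there gives absolute convergence at \<open>r\<close>.\<close>
  have "summable (\<lambda>i. a i * of_real ((1 + r) / 2) ^ i)"
    using sf[of "of_real ((1 + r) / 2)"] r by (auto simp: sums_iff simp del: of_real_divide of_real_add)
  then have "summable (\<lambda>i. norm (a i * complex_of_real r ^ i))"
    by (rule powser_insidea) (use r in \<open>simp del: of_real_divide of_real_add\<close>)
  then have sr: "summable (\<lambda>i. cmod (a i) * r ^ i)"
    using r by (simp add: norm_mult norm_power)
  have bound: "norm (F i z) \<le> cmod (a i) * r ^ i" if "z \<in> unit_disk" for i z
  proof (cases "z \<in> ball 0 r")
    case True
    then have "cmod z ^ i * cmod z ^ n \<le> r ^ i * 1"
      using r that by (intro mult_mono power_mono power_le_one) auto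
    then show ?thesis
      using True by (simp add: F_def norm_mult norm_power mult_left_mono)
  qed (use r in \<open>simp add: F_def\<close>)
  have meas: "F i \<in> borel_measurable disk_area" for i
    unfolding F_def by (intro borel_measurable_disk_area borel_measurable_scaleR
        borel_measurable_indicator borel_measurable_continuous_onI continuous_intros) auto
  have int: "integrable disk_area (F i)" for i
    by (rule disk_area.integrable_const_bound[OF AE_I2 meas]) (use bound in auto)
  have "(\<lambda>i. LINT z|disk_area. F i z) sums (LINT z|disk_area. (\<Sum>i. F i z))"
  proof (rule sums_integral[OF int AE_I2])
    fix z assume "z \<in> space disk_area"
    then show "summable (\<lambda>i. norm (F i z))"
      by (intro summable_comparison_test'[OF sr, of 0]) (use bound in auto)
  next
    have "(LINT z|disk_area. norm (F i z)) \<le> cmod (a i) * r ^ i" for i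
    proof -
      have "(LINT z|disk_area. norm (F i z)) \<le> (LINT z|disk_area. cmod (a i) * r ^ i)"
        using int[of i] bound by (intro integral_mono) auto
      also have "\<dots> = cmod (a i) * r ^ i"
        by (simp add: measure_def emeasure_disk_area_space)
      finally show ?thesis .
    qed
    then show "summable (\<lambda>i. LINT z|disk_area. norm (F i z))"
      by (intro summable_comparison_test'[OF sr, of 0]) simp
  qed
  also have "(LINT z|disk_area. (\<Sum>i. F i z))
      = (LINT z|disk_area. indicator (ball 0 r) z *\<^sub>R (f z * cnj z ^ n))"
  proof (rule Bochner_Integration.integral_cong[OF refl])
    fix z assume "z \<in> space disk_area"
    then have "(\<lambda>i. indicator (ball 0 r) z *\<^sub>R ((a i * z ^ i) * cnj z ^ n)) sums
        (indicator (ball 0 r) z *\<^sub>R (f z * cnj z ^ n))"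
      by (intro sums_scaleR_right sums_mult2 sf) simp
    then show "(\<Sum>i. F i z) = indicator (ball 0 r) z *\<^sub>R (f z * cnj z ^ n)"
      by (simp add: F_def sums_iff mult.assoc)
  qed
  also have "(\<lambda>i. LINT z|disk_area. F i z) = (\<lambda>i. if i = n then LINT z|disk_area. F n z else 0)"
  proof
    fix i
    have "(LINT z|disk_area. F i z)
        = a i * (LINT z|disk_area. indicator (ball 0 r) z *\<^sub>R (z ^ i * cnj z ^ n))"
      unfolding F_def by (subst integral_mult_right_zero [symmetric]) (simp add: mult.left_commute)
    then show "(LINT z|disk_area. F i z) = (if i = n then LINT z|disk_area. F n z else 0)"
      by (cases "i = n") (simp_all add: monomials_orthogonal)
  qed
  finally have "(LINT z|disk_area. indicator (ball 0 r) z *\<^sub>R (f z * cnj z ^ n))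
      = (LINT z|disk_area. F n z)"
    using sums_single[of n "\<lambda>i. LINT z|disk_area. F n z"] sums_unique2 by blast
  also have "\<dots> = (LINT z|disk_area. a n * of_real (indicator (ball 0 r) z * cmod z ^ (2 * n)))"
    unfolding F_def power_mult_cnj_power
    by (simp add: scaleR_conv_of_real mult.left_commute del: of_real_power)
  also have "\<dots> = a n * of_real (LINT z|disk_area. indicator (ball 0 r) z * cmod z ^ (2 * n))"
    by (simp only: integral_mult_right_zero integral_complex_of_real)
  finally show ?thesis by (simp add: a_def)
qed

lemma bergman_inner_scale_left: "bergman_inner (\<lambda>z. a * f z) g = a * bergman_inner f g"
  unfolding bergman_inner_def by (simp add: mult.assoc)

lemma bergman_inner_scale_right: "bergman_inner f (\<lambda>z. a * g z) = cnj a * bergman_inner f g"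
  unfolding bergman_inner_def by (simp add: mult.left_commute)

definition disk_monomial :: "nat \<Rightarrow> complex \<Rightarrow> complex" where
  "disk_monomial n = (\<lambda>z. if z \<in> unit_disk then z ^ n else 0)"

lemma bergmanI_bounded:
  assumes f: "f holomorphic_on unit_disk" and "\<And>z. z \<in> unit_disk \<Longrightarrow> cmod (f z) \<le> B"
  shows "(\<lambda>z. if z \<in> unit_disk then f z else 0) \<in> bergman"
proof -
  let ?g = "\<lambda>z. if z \<in> unit_disk then f z else 0"
  have hol: "?g holomorphic_on unit_disk"
    using f by (rule holomorphic_transform) auto
  have "?g \<in> borel_measurable disk_area"
    using hol by (intro borel_measurable_continuous_on_disk sets_disk_area
        holomorphic_on_imp_continuous_on)
  then have m: "(\<lambda>z. (cmod (?g z))\<^sup>2) \<in> borel_measurable disk_area"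
    by measurable
  have "integrable disk_area (\<lambda>z. (cmod (?g z))\<^sup>2)"
    by (rule disk_area.integrable_const_bound[OF AE_I2 m, of "B\<^sup>2"])
       (use assms(2) in \<open>auto intro!: power_mono\<close>)
  then show ?thesis using hol by (simp add: bergman_def)
qed

lemma disk_monomial_bergman: "disk_monomial n \<in> bergman"
  unfolding disk_monomial_def
  by (rule bergmanI_bounded[where B = 1])
     (auto intro!: holomorphic_intros simp: norm_power power_le_one)

text \<open>The radius of the truncated formula tends to 1, by dominated convergence. The factor is
  \<open>fact n\<close> from the Taylor coefficient times \<open>n + 1\<close> from the squared norm
  of the monomial.\<close>

lemma higher_deriv_at_0_bergman:
  assumes f: "f \<in> bergman"
  shows "(deriv ^^ n) f 0 = fact (n + 1) * bergman_inner f (disk_monomial n)"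
proof -
  \<comment> \<open>The radii are 1 - 1/(N+2); the shift by 2 makes even the first one
    positive.\<close>
  define r where "r = (\<lambda>N. 1 - inverse (real (Suc N) + 1))"
  have r: "0 < r N" "r N < 1" for N
    by (auto simp: r_def field_simps)
  have "r \<longlonglongrightarrow> 1 - 0"
    unfolding r_def
    by (intro tendsto_intros)
       (use LIMSEQ_ignore_initial_segment[OF LIMSEQ_inverse_real_of_nat, of 1] in \<open>simp add: add_ac\<close>)
  then have r1: "r \<longlonglongrightarrow> 1" by simp
  have ind: "(\<lambda>N. indicator (ball 0 (r N)) z :: real) \<longlonglongrightarrow> 1" if "z \<in> unit_disk" for z :: complex
  proof (rule tendsto_eventually)
    have "\<forall>\<^sub>F N in sequentially. cmod z < r N"
      using order_tendstoD(1)[OF r1, of "cmod z"] that by simp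
    then show "\<forall>\<^sub>F N in sequentially. indicator (ball 0 (r N)) z = (1::real)"
      by eventually_elim simp
  qed
  have int: "integrable disk_area (\<lambda>z. f z * cnj z ^ n)"
    using bergman_integrable_inner[OF f disk_monomial_bergman[of n]]
    by (rule Bochner_Integration.integrable_cong[THEN iffD1, rotated -1])
       (auto simp: disk_monomial_def)
  have "(\<lambda>N. LINT z|disk_area. indicator (ball 0 (r N)) z *\<^sub>R (f z * cnj z ^ n))
      \<longlonglongrightarrow> (LINT z|disk_area. f z * cnj z ^ n)"
  proof (rule integral_dominated_convergence)
    show "integrable disk_area (\<lambda>z. norm (f z * cnj z ^ n))"
      using int by (rule integrable_norm)
    show "AE z in disk_area.
        (\<lambda>N. indicator (ball 0 (r N)) z *\<^sub>R (f z * cnj z ^ n)) \<longlonglongrightarrow> f z * cnj z ^ n"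
      using tendsto_scaleR[OF ind tendsto_const] by (intro AE_I2) fastforce
    show "(\<lambda>z. indicator (ball 0 (r N)) z *\<^sub>R (f z * cnj z ^ n)) \<in> borel_measurable disk_area" for N
      by (intro borel_measurable_scaleR[OF _ borel_measurable_integrable[OF int]]
          borel_measurable_disk_area borel_measurable_indicator) auto
    show "AE z in disk_area. norm (indicator (ball 0 (r N)) z *\<^sub>R (f z * cnj z ^ n))
        \<le> norm (f z * cnj z ^ n)" for N
      by (intro AE_I2) (auto simp: indicator_def)
  qed (use borel_measurable_integrable[OF int] in simp)
  moreover have "(\<lambda>N. LINT z|disk_area. indicator (ball 0 (r N)) z *\<^sub>R (f z * cnj z ^ n))
      \<longlonglongrightarrow> (deriv ^^ n) f 0 / fact n * of_real (1 / (real n + 1))"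
  proof -
    have m: "(\<lambda>z. cmod z ^ (2 * n)) \<in> borel_measurable disk_area"
      by (intro borel_measurable_disk_area) measurable
    have i: "integrable disk_area (\<lambda>z. cmod z ^ (2 * n))"
      by (rule disk_area.integrable_const_bound[OF AE_I2 m, of 1]) (auto intro!: power_le_one)
    have "(\<lambda>N. LINT z|disk_area. indicator (ball 0 (r N)) z * cmod z ^ (2 * n))
        \<longlonglongrightarrow> (LINT z|disk_area. cmod z ^ (2 * n))"
    proof (rule integral_dominated_convergence[OF _ _ i])
      show "AE z in disk_area.
          (\<lambda>N. indicator (ball 0 (r N)) z * cmod z ^ (2 * n)) \<longlonglongrightarrow> cmod z ^ (2 * n)"
        using tendsto_mult[OF ind tendsto_const] by (intro AE_I2) fastforce
      show "(\<lambda>z. indicator (ball 0 (r N)) z * cmod z ^ (2 * n)) \<in> borel_measurable disk_area" for N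
        using m
        by (intro borel_measurable_times borel_measurable_disk_area borel_measurable_indicator) auto
      show "AE z in disk_area. norm (indicator (ball 0 (r N)) z * cmod z ^ (2 * n))
          \<le> cmod z ^ (2 * n)" for N
        by (intro AE_I2) (auto simp: indicator_def)
    qed (rule m)
    then show ?thesis
      unfolding integral_truncated_monomial[OF bergmanD(1)[OF f] r] integral_norm_power_disk_area
      by (intro tendsto_intros)
  qed
  ultimately have "(LINT z|disk_area. f z * cnj z ^ n)
      = (deriv ^^ n) f 0 / fact n * of_real (1 / (real n + 1))"
    by (rule LIMSEQ_unique)
  moreover have "(LINT z|disk_area. f z * cnj z ^ n) = bergman_inner f (disk_monomial n)"
    unfolding bergman_inner_def
    by (rule Bochner_Integration.integral_cong) (auto simp: disk_monomial_def)
  moreover define q where "q = complex_of_nat (Suc n)"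
  moreover have "complex_of_real (1 / (real n + 1)) = 1 / q" "fact (n + 1) = q * fact n"
    unfolding q_def by (simp_all add: add.commute)
  moreover have "q \<noteq> 0" unfolding q_def by (rule of_nat_neq_0)
  ultimately show ?thesis by (simp del: of_nat_Suc fact_Suc)
qed

section \<open>Derivatives and power series of the kernel\<close>

lemma one_minus_mult_neq_0:
  fixes c w :: complex
  assumes "cmod c \<le> 1" "w \<in> unit_disk"
  shows "1 - c * w \<noteq> 0"
proof
  assume "1 - c * w = 0"
  then have "1 = cmod c * cmod w" by (metis norm_mult norm_one right_minus_eq)
  also have "\<dots> \<le> 1 * cmod w" using assms by (intro mult_right_mono) auto
  finally show False using assms by simp
qed

lemma higher_deriv_kernel:
  assumes "cmod c \<le> 1" "z \<in> unit_disk"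
  shows "(deriv ^^ j) (\<lambda>w. 1 / (1 - c * w)\<^sup>2) z = fact (j + 1) * c ^ j / (1 - c * z) ^ (j + 2)"
  using assms(2)
proof (induction j arbitrary: z)
  case 0
  then show ?case by (simp add: power2_eq_square)
next
  case (Suc j)
  have nz: "1 - c * z \<noteq> 0" by (rule one_minus_mult_neq_0) (use assms Suc in auto)
  have "(deriv ^^ Suc j) (\<lambda>w. 1 / (1 - c * w)\<^sup>2) z = deriv ((deriv ^^ j) (\<lambda>w. 1 / (1 - c * w)\<^sup>2)) z"
    by simp
  also have "\<dots> = deriv (\<lambda>w. fact (j + 1) * c ^ j / (1 - c * w) ^ (j + 2)) z"
    by (intro deriv_cong_ev refl
        eventually_mono[OF eventually_nhds_in_open[OF open_ball Suc.prems] Suc.IH])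
  also have "\<dots> = fact (Suc j + 1) * c ^ Suc j / (1 - c * z) ^ (Suc j + 2)"
  proof (rule DERIV_imp_deriv)
    have "((\<lambda>w. 1 - c * w) has_field_derivative - c) (at z)"
      by (auto intro!: derivative_eq_intros)
    from DERIV_power[OF this, of "j + 2"]
    have d: "((\<lambda>w. (1 - c * w) ^ (j + 2)) has_field_derivative
        of_nat (j + 2) * (1 - c * z) ^ (j + 1) * (- c)) (at z)"
      by (simp add: mult_ac)
    have "((\<lambda>w. fact (j + 1) * c ^ j / (1 - c * w) ^ (j + 2)) has_field_derivative
        (0 * (1 - c * z) ^ (j + 2) - fact (j + 1) * c ^ j * (of_nat (j + 2) * (1 - c * z) ^ (j + 1) * (- c)))
         / ((1 - c * z) ^ (j + 2) * (1 - c * z) ^ (j + 2))) (at z)"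
      using nz by (intro DERIV_divide DERIV_const d) simp
    also have "(0 * (1 - c * z) ^ (j + 2) - fact (j + 1) * c ^ j * (of_nat (j + 2) * (1 - c * z) ^ (j + 1) * (- c)))
         / ((1 - c * z) ^ (j + 2) * (1 - c * z) ^ (j + 2))
        = fact (Suc j + 1) * c ^ Suc j / (1 - c * z) ^ (Suc j + 2)"
    proof -
      \<comment> \<open>Here \<open>u * p\<close> is the power of exponent \<open>j + 2\<close> with
        one factor split off, so that the common factor \<open>p\<close> of exponent
        \<open>j + 1\<close> cancels in the quotient rule.\<close>
      have "(0 * (u * p) - a * (k * p * (- c))) / ((u * p) * (u * p)) = k * a * c / (u * u * p)"
        if "u \<noteq> 0" "p \<noteq> 0" for a k p u :: complex
        using that by (simp add: field_simps)
      from this[of "1 - c * z" "(1 - c * z) ^ (j + 1)" "fact (j + 1) * c ^ j" "of_nat (j + 2)"]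
      show ?thesis using nz by (simp add: mult_ac power2_eq_square)
    qed
    finally show "((\<lambda>w. fact (j + 1) * c ^ j / (1 - c * w) ^ (j + 2)) has_field_derivative
        fact (Suc j + 1) * c ^ Suc j / (1 - c * z) ^ (Suc j + 2)) (at z)" .
  qed
  finally show ?case .
qed

lemma sums_kernel:
  assumes "cmod c \<le> 1" "z \<in> unit_disk"
  shows "(\<lambda>m. fact (j + m + 1) / fact m * c ^ (j + m) * z ^ m) sums
    (fact (j + 1) * c ^ j / (1 - c * z) ^ (j + 2))"
proof -
  have "(\<lambda>w. 1 / (1 - c * w)\<^sup>2) holomorphic_on unit_disk"
    using one_minus_mult_neq_0[OF assms(1)] by (auto intro!: holomorphic_intros)
  from sums_higher_deriv[OF this assms(2), of j] show ?thesis
    using higher_deriv_kernel[OF assms(1), of 0] higher_deriv_kernel[OF assms, of j] by simp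
qed

text \<open>The kernel series at the boundary value \<open>c = 1\<close>, where all coefficients are
  positive. It is the majorant for integrating the kernel expansion term by term, against area as
  well as against \<open>\<mu>\<close>.\<close>

lemma summable_kernel:
  fixes r :: real
  assumes "0 \<le> r" "r < 1"
  shows "summable (\<lambda>m. fact (j + m + 1) / fact m * r ^ m)"
proof -
  have "summable (\<lambda>m. Re (fact (j + m + 1) / fact m * 1 ^ (j + m) * of_real r ^ m))"
    using sums_kernel[of 1 "of_real r" j] assms by (intro summable_Re) (auto simp: sums_iff)
  also have "(\<lambda>m. Re (fact (j + m + 1) / fact m * 1 ^ (j + m) * of_real r ^ m))
      = (\<lambda>m. fact (j + m + 1) / fact m * r ^ m)"
  proof
    fix m
    have "fact (j + m + 1) / fact m * 1 ^ (j + m) * of_real r ^ m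
        = complex_of_real (fact (j + m + 1) / fact m * r ^ m)"
      by simp
    then show "Re (fact (j + m + 1) / fact m * 1 ^ (j + m) * of_real r ^ m)
        = fact (j + m + 1) / fact m * r ^ m"
      by (simp only: Re_complex_of_real)
  qed
  finally show ?thesis .
qed

text \<open>The element of the Bergman space representing the functional \<open>f \<mapsto> f\<^sup>(\<^sup>j\<^sup>)(z)\<close>.\<close>

definition deriv_kernel :: "nat \<Rightarrow> complex \<Rightarrow> complex \<Rightarrow> complex" where
  "deriv_kernel j z =
     (\<lambda>w. if w \<in> unit_disk then fact (j + 1) * w ^ j / (1 - cnj z * w) ^ (j + 2) else 0)"

lemma deriv_kernel_bergman:
  assumes z: "z \<in> unit_disk"
  shows "deriv_kernel j z \<in> bergman"
  unfolding deriv_kernel_def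
proof (rule bergmanI_bounded)
  show "(\<lambda>w. fact (j + 1) * w ^ j / (1 - cnj z * w) ^ (j + 2)) holomorphic_on unit_disk"
    using z one_minus_mult_neq_0[of "cnj z"] by (auto intro!: holomorphic_intros)
  fix w :: complex assume w: "w \<in> unit_disk"
  have "cmod z * cmod w \<le> cmod z * 1"
    using w by (intro mult_left_mono) auto
  then have "1 - cmod z \<le> cmod (1 - cnj z * w)"
    using norm_triangle_ineq2[of 1 "cnj z * w"] by (simp add: norm_mult)
  moreover have "cmod w ^ j \<le> 1" using w by (intro power_le_one) auto
  ultimately show "cmod (fact (j + 1) * w ^ j / (1 - cnj z * w) ^ (j + 2))
      \<le> fact (j + 1) * 1 / (1 - cmod z) ^ (j + 2)"
    unfolding norm_divide norm_mult norm_power norm_fact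
    using z by (intro frac_le mult_left_mono power_mono mult_nonneg_nonneg) auto
qed

text \<open>Exchanges the two points: the integrand of \<open>toeplitz\<close> contains the kernel
  based at \<open>z\<close>, differentiated at the integration variable \<open>w\<close>, and this
  turns it into the representer based at \<open>w\<close>, evaluated at \<open>z\<close>.\<close>

lemma higher_deriv_bergman_kernel:
  assumes z: "z \<in> unit_disk" and w: "w \<in> unit_disk"
  shows "(deriv ^^ j) (bergman_kernel z) w = cnj (deriv_kernel j w z)"
proof -
  have "(\<lambda>w. 1 / (1 - cnj z * w)\<^sup>2) holomorphic_on unit_disk"
    using z one_minus_mult_neq_0[of "cnj z"] by (auto intro!: holomorphic_intros)
  moreover from this have "bergman_kernel z holomorphic_on unit_disk"
    by (rule holomorphic_transform) (simp add: bergman_kernel_def)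
  ultimately have "(deriv ^^ j) (bergman_kernel z) w = (deriv ^^ j) (\<lambda>w. 1 / (1 - cnj z * w)\<^sup>2) w"
    using w by (intro higher_deriv_transform_within_open[where S = unit_disk])
      (auto simp: bergman_kernel_def)
  also have "\<dots> = fact (j + 1) * cnj z ^ j / (1 - cnj z * w) ^ (j + 2)"
    using z w by (intro higher_deriv_kernel) auto
  finally show ?thesis using z by (simp add: deriv_kernel_def mult.commute)
qed

text \<open>For fixed \<open>z\<close> the kernel is a power series in \<open>z\<close> whose
  coefficients are monomials in \<open>cnj w\<close>, with a majorant uniform in \<open>w\<close>.
  Termwise integration against \<open>f\<close> yields inner products with monomials, which are the
  derivatives of \<open>f\<close> at 0 up to factors.\<close>

lemma reproducing_deriv_kernel:
  assumes f: "f \<in> bergman" and z: "z \<in> unit_disk"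
  shows "bergman_inner f (deriv_kernel j z) = (deriv ^^ j) f z"
proof -
  define b where "b = (\<lambda>m. fact (j + m + 1) / fact m * cmod z ^ m)"
  define F where "F = (\<lambda>m w. fact (j + m + 1) / fact m * z ^ m * (f w * cnj (disk_monomial (j + m) w)))"
  have b: "summable b"
    unfolding b_def using z by (intro summable_kernel) auto
  have b0: "0 \<le> b m" for m by (simp add: b_def)
  have int: "integrable disk_area (F m)" for m
    unfolding F_def using bergman_integrable_inner[OF f disk_monomial_bergman] by simp
  \<comment> \<open>The monomial of degree 0 is 1 on the disk, so pairing with it turns square
    integrability into integrability.\<close>
  have intf: "integrable disk_area (\<lambda>w. cmod (f w))"
  proof (rule integrable_norm)
    have "integrable disk_area f \<longleftrightarrow> integrable disk_area (\<lambda>w. f w * cnj (disk_monomial 0 w))"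
      by (rule Bochner_Integration.integrable_cong) (auto simp: disk_monomial_def)
    then show "integrable disk_area f"
      using bergman_integrable_inner[OF f disk_monomial_bergman] by blast
  qed
  have bound: "norm (F m w) \<le> b m * cmod (f w)" for m w
  proof -
    have "cmod (disk_monomial (j + m) w) \<le> 1"
      by (auto simp: disk_monomial_def norm_power intro!: power_le_one)
    then have "cmod (f w) * cmod (disk_monomial (j + m) w) \<le> cmod (f w)"
      by (simp add: mult_left_le)
    moreover have "norm (F m w) = b m * (cmod (f w) * cmod (disk_monomial (j + m) w))"
      by (simp add: F_def b_def norm_mult norm_divide norm_power del: fact_Suc)
    ultimately show ?thesis using b0 by (simp add: mult_left_mono)
  qed
  have "(\<lambda>m. LINT w|disk_area. F m w) sums (LINT w|disk_area. (\<Sum>m. F m w))"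
  proof (rule sums_integral[OF int AE_I2])
    fix w
    show "summable (\<lambda>m. norm (F m w))"
      by (rule summable_comparison_test'[OF summable_mult2[OF b, of "cmod (f w)"], of 0])
         (use bound in simp)
  next
    have "(LINT w|disk_area. norm (F m w)) \<le> b m * (LINT w|disk_area. cmod (f w))" for m
    proof -
      have "(LINT w|disk_area. norm (F m w)) \<le> (LINT w|disk_area. b m * cmod (f w))"
        using int intf bound by (intro integral_mono) auto
      then show ?thesis by simp
    qed
    then show "summable (\<lambda>m. LINT w|disk_area. norm (F m w))"
      by (intro summable_comparison_test'[OF summable_mult2[OF b, of "LINT w|disk_area. cmod (f w)"], of 0])
         simp
  qed
  also have "(LINT w|disk_area. (\<Sum>m. F m w)) = bergman_inner f (deriv_kernel j z)"
    unfolding bergman_inner_def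
  proof (rule Bochner_Integration.integral_cong[OF refl])
    fix w assume "w \<in> space disk_area"
    then have w: "w \<in> unit_disk" by simp
    have "(\<lambda>m. f w * (fact (j + m + 1) / fact m * cnj w ^ (j + m) * z ^ m)) sums
        (f w * (fact (j + 1) * cnj w ^ j / (1 - cnj w * z) ^ (j + 2)))"
      using w z by (intro sums_mult sums_kernel) auto
    moreover have "f w * (fact (j + m + 1) / fact m * cnj w ^ (j + m) * z ^ m) = F m w" for m
      using w by (simp add: F_def disk_monomial_def mult_ac)
    ultimately have "(\<lambda>m. F m w) sums (f w * (fact (j + 1) * cnj w ^ j / (1 - cnj w * z) ^ (j + 2)))"
      by simp
    then show "(\<Sum>m. F m w) = f w * cnj (deriv_kernel j z w)"
      using w by (simp add: sums_iff deriv_kernel_def mult.commute)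
  qed
  \<comment> \<open>The factor \<open>fact (j + m + 1)\<close> of the kernel is exactly the one that
    turns the inner product with a monomial into a derivative at 0.\<close>
  also have "(\<lambda>m. LINT w|disk_area. F m w) = (\<lambda>m. (deriv ^^ (j + m)) f 0 / fact m * z ^ m)"
    unfolding higher_deriv_at_0_bergman[OF f] F_def bergman_inner_def
    by (simp only: integral_mult_right_zero) (simp add: mult_ac)
  finally show ?thesis
    using sums_higher_deriv[OF bergmanD(1)[OF f] z, of j] sums_unique2 by blast
qed

lemma higher_deriv_bound:
  assumes f: "f \<in> bergman" and z: "z \<in> unit_disk"
  shows "cmod ((deriv ^^ j) f z) \<le> bergman_norm f * bergman_norm (deriv_kernel j z)"
  using bergman_Cauchy_Schwarz[OF f deriv_kernel_bergman[OF z]] reproducing_deriv_kernel[OF f z]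
  by metis

section \<open>Orthonormal bases\<close>

lemma bergman_norm_sum_orthonormal:
  assumes "finite F" and h: "\<And>i. i \<in> F \<Longrightarrow> h i \<in> bergman"
    and on: "\<And>i j. i \<in> F \<Longrightarrow> j \<in> F \<Longrightarrow> bergman_inner (h i) (h j) = (if i = j then 1 else 0)"
  shows "(bergman_norm (\<lambda>z. \<Sum>i\<in>F. c i * h i z))\<^sup>2 = (\<Sum>i\<in>F. (cmod (c i))\<^sup>2)"
proof -
  define p where "p = (\<lambda>z. \<Sum>i\<in>F. c i * h i z)"
  have p: "p \<in> bergman" unfolding p_def by (intro bergman_sum assms)
  have ph: "bergman_inner p (h i) = c i" if "i \<in> F" for i
  proof -
    have "bergman_inner p (h i) = (\<Sum>j\<in>F. c j * bergman_inner (h j) (h i))"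
      unfolding p_def by (intro bergman_inner_sum_left assms that)
    also have "\<dots> = (\<Sum>j\<in>F. if j = i then c j else 0)"
      using on that by (intro sum.cong) auto
    finally show ?thesis using \<open>finite F\<close> that by simp
  qed
  have "complex_of_real ((bergman_norm p)\<^sup>2) = bergman_inner p p"
    by (rule bergman_inner_self [symmetric])
  also have "\<dots> = (\<Sum>i\<in>F. c i * bergman_inner (h i) p)"
    by (subst (1) p_def) (intro bergman_inner_sum_left assms p)
  also have "\<dots> = (\<Sum>i\<in>F. c i * cnj (c i))"
    by (intro sum.cong refl) (metis ph bergman_inner_cnj)
  also have "\<dots> = complex_of_real (\<Sum>i\<in>F. (cmod (c i))\<^sup>2)"
    by (simp add: complex_norm_square [symmetric] del: of_real_power)
  finally show ?thesis unfolding p_def by (simp only: of_real_eq_iff)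
qed

text \<open>Completing the square in the coefficients: the choice of
  \<open>bergman_inner f (h i)\<close> for \<open>c i\<close> is optimal and gives Bessel's
  inequality. Indexed families cover both sets of functions, with \<open>h\<close> the identity, and
  the sequence of monomials.\<close>

lemma bergman_norm_diff_orthonormal:
  assumes f: "f \<in> bergman" and F: "finite F" and h: "\<And>i. i \<in> F \<Longrightarrow> h i \<in> bergman"
    and on: "\<And>i j. i \<in> F \<Longrightarrow> j \<in> F \<Longrightarrow> bergman_inner (h i) (h j) = (if i = j then 1 else 0)"
  shows "(bergman_norm (\<lambda>z. f z - (\<Sum>i\<in>F. c i * h i z)))\<^sup>2
    = (bergman_norm f)\<^sup>2 - (\<Sum>i\<in>F. (cmod (bergman_inner f (h i)))\<^sup>2)
      + (\<Sum>i\<in>F. (cmod (c i - bergman_inner f (h i)))\<^sup>2)"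
proof -
  define p where "p = (\<lambda>z. \<Sum>i\<in>F. c i * h i z)"
  define d where "d = (\<lambda>i. bergman_inner f (h i))"
  have p: "p \<in> bergman" unfolding p_def by (intro bergman_sum F h)
  have pf: "bergman_inner p f = (\<Sum>i\<in>F. c i * cnj (d i))"
    unfolding p_def d_def by (subst bergman_inner_sum_left) (simp_all add: F h f bergman_inner_cnj)
  have pp: "bergman_inner p p = (\<Sum>i\<in>F. c i * cnj (c i))"
    unfolding bergman_inner_self using bergman_norm_sum_orthonormal[of F h c] F h on
    by (simp add: p_def complex_norm_square [symmetric] del: of_real_power)
  have fp: "bergman_inner f p = (\<Sum>i\<in>F. cnj (c i) * d i)"
    by (subst bergman_inner_cnj [symmetric]) (simp add: pf)
  have fmp: "(\<lambda>z. f z - p z) \<in> bergman" by (rule bergman_diff[OF f p])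
  have "complex_of_real ((bergman_norm (\<lambda>z. f z - p z))\<^sup>2)
      = bergman_inner (\<lambda>z. f z - p z) (\<lambda>z. f z - p z)"
    by (rule bergman_inner_self [symmetric])
  also have "\<dots> = cnj (bergman_inner (\<lambda>z. f z - p z) f) - cnj (bergman_inner (\<lambda>z. f z - p z) p)"
    unfolding bergman_inner_cnj by (rule bergman_inner_diff_left[OF f p fmp])
  also have "\<dots> = cnj (bergman_inner f f - bergman_inner p f) - cnj (bergman_inner f p - bergman_inner p p)"
    by (simp only: bergman_inner_diff_left[OF f p f] bergman_inner_diff_left[OF f p p])
  also have "\<dots> = bergman_inner f f - bergman_inner p f - bergman_inner f p + bergman_inner p p"
    by (simp add: bergman_inner_cnj)
  also have "\<dots> = bergman_inner f f - (\<Sum>i\<in>F. d i * cnj (d i))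
      + (\<Sum>i\<in>F. (c i - d i) * cnj (c i - d i))"
    unfolding pf fp pp by (simp add: algebra_simps sum.distrib sum_subtractf)
  also have "\<dots> = complex_of_real ((bergman_norm f)\<^sup>2 - (\<Sum>i\<in>F. (cmod (d i))\<^sup>2)
      + (\<Sum>i\<in>F. (cmod (c i - d i))\<^sup>2))"
    unfolding bergman_inner_self by (simp only: complex_norm_square of_real_add of_real_diff of_real_sum)
  finally show ?thesis unfolding p_def d_def by (simp only: of_real_eq_iff)
qed

lemma onb_Parseval:
  assumes E: "bergman_onb E" and f: "f \<in> bergman"
  shows "((\<lambda>e. (cmod (bergman_inner f e))\<^sup>2) has_sum (bergman_norm f)\<^sup>2) E"
  unfolding has_sum_def tendsto_iff eventually_finite_subsets_at_top
proof (intro allI impI)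
  fix \<epsilon> :: real assume "\<epsilon> > 0"
  \<comment> \<open>The tolerance is \<open>sqrt \<epsilon>\<close> because the identity to be used
    concerns squared norms.\<close>
  then obtain F c where F: "finite F" "F \<subseteq> E"
    and Fc: "bergman_norm (\<lambda>z. f z - (\<Sum>e\<in>F. c e * e z)) < sqrt \<epsilon>"
    using E f unfolding bergman_onb_def by (meson real_sqrt_gt_zero)
  have "dist (\<Sum>e\<in>G. (cmod (bergman_inner f e))\<^sup>2) ((bergman_norm f)\<^sup>2) < \<epsilon>"
    if G: "finite G" "F \<subseteq> G" "G \<subseteq> E" for G
  proof -
    have GE: "e \<in> bergman" if "e \<in> G" for e
      using that G E by (auto simp: bergman_onb_def)
    have on: "bergman_inner e e' = (if e = e' then 1 else 0)" if "e \<in> G" "e' \<in> G" for e e'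
    proof -
      have "\<forall>e\<in>E. \<forall>e'\<in>E. bergman_inner e e' = (if e = e' then 1 else 0)"
        using E by (simp add: bergman_onb_def)
      then show ?thesis using that G(3) by blast
    qed
    note id = bergman_norm_diff_orthonormal[OF f G(1), of "\<lambda>e. e"]
    \<comment> \<open>Extended by zero, the approximating combination becomes a competitor over the
      larger set \<open>G\<close>, and the optimal coefficients there do at least as well.\<close>
    define c' where "c' = (\<lambda>e. if e \<in> F then c e else 0)"
    have "(\<Sum>e\<in>F. c e * e z) = (\<Sum>e\<in>G. c' e * e z)" for z
      using G by (intro sum.mono_neutral_cong_left) (auto simp: c'_def)
    then have "(bergman_norm (\<lambda>z. f z - (\<Sum>e\<in>G. c' e * e z)))\<^sup>2 < (sqrt \<epsilon>)\<^sup>2"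
      using Fc by (intro power_strict_mono) (auto simp: bergman_norm_nonneg)
    then have "(bergman_norm f)\<^sup>2 - (\<Sum>e\<in>G. (cmod (bergman_inner f e))\<^sup>2)
      + (\<Sum>e\<in>G. (cmod (c' e - bergman_inner f e))\<^sup>2) < \<epsilon>"
      using id[of c'] GE on \<open>\<epsilon> > 0\<close> by simp
    moreover have "0 \<le> (\<Sum>e\<in>G. (cmod (c' e - bergman_inner f e))\<^sup>2)"
      by (intro sum_nonneg) simp
    moreover have "0 \<le> (bergman_norm f)\<^sup>2 - (\<Sum>e\<in>G. (cmod (bergman_inner f e))\<^sup>2)"
      using id[of "\<lambda>e. bergman_inner f e"] GE on
      by (simp flip: zero_le_power2)
        (metis (no_types, lifting) diff_ge_0_iff_ge zero_le_power2)
    ultimately show ?thesis by (simp add: dist_real_def)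
  qed
  with F show "\<exists>X. finite X \<and> X \<subseteq> E \<and> (\<forall>Y. finite Y \<and> X \<subseteq> Y \<and> Y \<subseteq> E \<longrightarrow>
      dist (\<Sum>e\<in>Y. (cmod (bergman_inner f e))\<^sup>2) ((bergman_norm f)\<^sup>2) < \<epsilon>)"
    by blast
qed

text \<open>Each monomial has only countably many non-zero coefficients with respect to
  \<open>E\<close>. A basis element orthogonal to all monomials would have zero Taylor series and
  could not have norm 1. Countability is what permits exchanging the sum over \<open>E\<close> with
  the integral against \<open>\<mu>\<close>.\<close>

lemma onb_countable:
  assumes E: "bergman_onb E"
  shows "countable E"
proof -
  have "countable {e \<in> E. (cmod (bergman_inner (disk_monomial n) e))\<^sup>2 \<noteq> 0}" for n
    using onb_Parseval[OF E disk_monomial_bergman] by (intro summable_countable_real has_sum_imp_summable)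
  then have "countable (\<Union>n. {e \<in> E. (cmod (bergman_inner (disk_monomial n) e))\<^sup>2 \<noteq> 0})"
    by (intro countable_UN) auto
  moreover have "E \<subseteq> (\<Union>n. {e \<in> E. (cmod (bergman_inner (disk_monomial n) e))\<^sup>2 \<noteq> 0})"
  proof
    fix e assume e: "e \<in> E"
    then have eb: "e \<in> bergman" and ee: "bergman_inner e e = 1"
      using E by (auto simp: bergman_onb_def)
    show "e \<in> (\<Union>n. {e \<in> E. (cmod (bergman_inner (disk_monomial n) e))\<^sup>2 \<noteq> 0})"
    proof (rule ccontr)
      assume "\<not> ?thesis"
      then have "bergman_inner (disk_monomial n) e = 0" for n using e by auto
      then have "(deriv ^^ n) e 0 = 0" for n
        using higher_deriv_at_0_bergman[OF eb, of n] bergman_inner_cnj[of "disk_monomial n" e]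
        by simp
      then have "e z = 0" for z
        using sums_higher_deriv[OF bergmanD(1)[OF eb], of z 0] bergmanD(3)[OF eb, of z]
        by (cases "z \<in> unit_disk") (auto simp: sums_iff)
      then show False using ee by (simp add: bergman_inner_def)
    qed
  qed
  ultimately show ?thesis by (rule countable_subset[rotated])
qed

section \<open>The orthonormal basis of monomials\<close>

definition normalized_monomial :: "nat \<Rightarrow> complex \<Rightarrow> complex" where
  "normalized_monomial n = (\<lambda>z. complex_of_real (sqrt (real n + 1)) * disk_monomial n z)"

lemma normalized_monomial_bergman: "normalized_monomial n \<in> bergman"
  unfolding normalized_monomial_def by (intro bergman_scale disk_monomial_bergman)

lemma normalized_monomial_orthonormal:
  "bergman_inner (normalized_monomial m) (normalized_monomial n) = (if m = n then 1 else 0)"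
proof -
  have "bergman_inner (disk_monomial m) (disk_monomial n)
      = (LINT z|disk_area. indicator (ball 0 1) z *\<^sub>R (z ^ m * cnj z ^ n))"
    unfolding bergman_inner_def
    by (rule Bochner_Integration.integral_cong) (auto simp: disk_monomial_def)
  moreover have "(LINT z|disk_area. indicator (ball 0 1) z *\<^sub>R (z ^ n * cnj z ^ n))
      = (LINT z|disk_area. complex_of_real (cmod z ^ (2 * n)))"
    by (rule Bochner_Integration.integral_cong)
       (auto simp: power_mult_cnj_power)
  ultimately have "bergman_inner (disk_monomial m) (disk_monomial n)
      = (if m = n then of_real (1 / (real n + 1)) else 0)"
    by (cases "m = n")
       (simp_all only: monomials_orthogonal integral_complex_of_real integral_norm_power_disk_area
          if_True if_False simp_thms)
  then have "bergman_inner (normalized_monomial m) (normalized_monomial n)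
      = complex_of_real (sqrt (real m + 1)) * complex_of_real (sqrt (real n + 1)) *
        (if m = n then of_real (1 / (real n + 1)) else 0)"
    by (simp add: normalized_monomial_def bergman_inner_scale_left bergman_inner_scale_right)
  also have "\<dots> = (if m = n then 1 else 0)"
    by (auto simp flip: of_real_mult) (metis of_nat_Suc of_nat_neq_0 add.commute)
  finally show ?thesis .
qed

text \<open>The orthonormal expansion is the Taylor expansion: the two square roots combine to
  \<open>n + 1\<close>, the quotient of \<open>fact (n + 1)\<close> and \<open>fact n\<close>. Only
  pointwise convergence is obtained here, which is what Fatou's lemma asks for.\<close>

lemma sums_normalized_monomial:
  assumes f: "f \<in> bergman"
  shows "(\<lambda>n. bergman_inner f (normalized_monomial n) * normalized_monomial n z) sums f z"
proof (cases "z \<in> unit_disk")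
  case True
  have "bergman_inner f (normalized_monomial n) * normalized_monomial n z
      = (deriv ^^ n) f 0 / fact n * z ^ n" for n
  proof -
    have "bergman_inner f (normalized_monomial n)
        = complex_of_real (sqrt (real n + 1)) * bergman_inner f (disk_monomial n)"
      by (simp add: normalized_monomial_def bergman_inner_scale_right)
    then have "bergman_inner f (normalized_monomial n) * normalized_monomial n z
        = complex_of_real (sqrt (real n + 1) * sqrt (real n + 1)) * (bergman_inner f (disk_monomial n) * z ^ n)"
      using True by (simp only: normalized_monomial_def disk_monomial_def if_True of_real_mult mult_ac)
    also have "sqrt (real n + 1) * sqrt (real n + 1) = real n + 1" by simp
    finally show ?thesis
      by (simp add: higher_deriv_at_0_bergman[OF f] add.commute)
  qed
  then show ?thesis using sums_higher_deriv[OF bergmanD(1)[OF f] True, of 0] by simp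
next
  case False
  then show ?thesis using bergmanD(3)[OF f False]
    by (simp add: normalized_monomial_def disk_monomial_def)
qed

text \<open>Density: by Fatou's lemma the norm is at most the limit of the norms of the Taylor
  polynomials, while by Bessel's inequality it is at least that.\<close>

lemma bergman_onb_normalized_monomials: "bergman_onb (range normalized_monomial)"
  unfolding bergman_onb_def
proof (intro conjI ballI allI impI)
  show "range normalized_monomial \<subseteq> bergman"
    using normalized_monomial_bergman by auto
  have inj: "inj normalized_monomial"
    by (rule injI) (metis normalized_monomial_orthonormal zero_neq_one)
  show "bergman_inner e e' = (if e = e' then 1 else 0)"
    if "e \<in> range normalized_monomial" "e' \<in> range normalized_monomial" for e e'
    using that inj by (auto simp: normalized_monomial_orthonormal inj_eq)
  fix f and \<epsilon> :: real assume f: "f \<in> bergman" and \<epsilon>: "0 < \<epsilon>"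
  define d where "d = (\<lambda>n. bergman_inner f (normalized_monomial n))"
  define p where "p = (\<lambda>N z. \<Sum>n<N. d n * normalized_monomial n z)"
  have pb: "p N \<in> bergman" for N
    unfolding p_def by (intro bergman_sum normalized_monomial_bergman) auto
  have norm_p: "(bergman_norm (p N))\<^sup>2 = (\<Sum>n<N. (cmod (d n))\<^sup>2)" for N
    unfolding p_def
    by (intro bergman_norm_sum_orthonormal normalized_monomial_bergman normalized_monomial_orthonormal) auto
  \<comment> \<open>With the optimal coefficients the last sum of the best approximation identity
    vanishes.\<close>
  have diff: "(bergman_norm (\<lambda>z. f z - p N z))\<^sup>2 = (bergman_norm f)\<^sup>2 - (\<Sum>n<N. (cmod (d n))\<^sup>2)" for N
    unfolding p_def d_def
    by (subst bergman_norm_diff_orthonormal[OF f])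
       (auto intro: normalized_monomial_bergman simp: normalized_monomial_orthonormal)
  have Bessel: "(\<Sum>n<N. (cmod (d n))\<^sup>2) \<le> (bergman_norm f)\<^sup>2" for N
    using diff[of N] by (metis diff_ge_0_iff_ge zero_le_power2)
  have sd: "summable (\<lambda>n. (cmod (d n))\<^sup>2)"
    by (rule summableI_nonneg_bounded[OF _ Bessel]) simp
  have lim: "(\<lambda>N. ennreal ((cmod (p N z))\<^sup>2)) \<longlonglongrightarrow> ennreal ((cmod (f z))\<^sup>2)" for z
    using sums_normalized_monomial[OF f, of z] unfolding sums_def p_def d_def
    by (intro tendsto_intros)
  have "ennreal ((bergman_norm f)\<^sup>2) = (\<integral>\<^sup>+ z. ennreal ((cmod (f z))\<^sup>2) \<partial>disk_area)"
    unfolding bergman_norm_square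
    by (rule nn_integral_eq_integral [symmetric]) (use bergmanD(2)[OF f] in auto)
  also have "\<dots> = (\<integral>\<^sup>+ z. liminf (\<lambda>N. ennreal ((cmod (p N z))\<^sup>2)) \<partial>disk_area)"
    using lim_imp_Liminf[OF _ lim] by simp
  also have "\<dots> \<le> liminf (\<lambda>N. \<integral>\<^sup>+ z. ennreal ((cmod (p N z))\<^sup>2) \<partial>disk_area)"
    by (rule nn_integral_liminf) (use bergmanD(4)[OF pb] in measurable)
  also have "\<dots> = liminf (\<lambda>N. ennreal (\<Sum>n<N. (cmod (d n))\<^sup>2))"
    unfolding norm_p [symmetric] bergman_norm_square
    using nn_integral_eq_integral[OF bergmanD(2)[OF pb]] by simp
  also have "\<dots> = ennreal (\<Sum>n. (cmod (d n))\<^sup>2)"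
    using summable_LIMSEQ[OF sd] by (intro lim_imp_Liminf tendsto_ennrealI) auto
  finally have le: "(bergman_norm f)\<^sup>2 \<le> (\<Sum>n. (cmod (d n))\<^sup>2)"
    using suminf_nonneg[OF sd] by (simp add: ennreal_le_iff)
  have "\<forall>\<^sub>F N in sequentially. (\<Sum>n. (cmod (d n))\<^sup>2) - \<epsilon>\<^sup>2 < (\<Sum>n<N. (cmod (d n))\<^sup>2)"
    using order_tendstoD(1)[OF summable_LIMSEQ[OF sd]] \<epsilon> by simp
  then obtain N where "(\<Sum>n. (cmod (d n))\<^sup>2) - \<epsilon>\<^sup>2 < (\<Sum>n<N. (cmod (d n))\<^sup>2)"
    by (auto simp: eventually_sequentially)
  then have "(bergman_norm (\<lambda>z. f z - p N z))\<^sup>2 < \<epsilon>\<^sup>2"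
    using diff[of N] le by simp
  then have "bergman_norm (\<lambda>z. f z - p N z) < \<epsilon>"
    using \<epsilon> by (intro power2_less_imp_less[of _ \<epsilon>]) auto
  moreover have "p N z = (\<Sum>e\<in>normalized_monomial ` {..<N}. bergman_inner f e * e z)" for z
    unfolding p_def d_def using inj by (subst sum.reindex) (auto intro: inj_on_subset)
  ultimately show "\<exists>F c. finite F \<and> F \<subseteq> range normalized_monomial
      \<and> bergman_norm (\<lambda>z. f z - (\<Sum>e\<in>F. c e * e z)) < \<epsilon>"
    by (intro exI[of _ "normalized_monomial ` {..<N}"] exI[of _ "bergman_inner f"]) auto
qed

section \<open>Wirtinger derivatives of the kernel\<close>

text \<open>\<open>frechet_derivative\<close> is meaningful only where the function is
  differentiable. Iterated Wirtinger derivatives therefore need rules that carry differentiability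
  along with both coefficients of the real differential.\<close>

definition wirtinger_diff :: "(complex \<Rightarrow> complex) \<Rightarrow> complex \<Rightarrow> complex \<Rightarrow> complex \<Rightarrow> bool" where
  "wirtinger_diff h G D z \<longleftrightarrow> (h has_derivative (\<lambda>v. G * v + D * cnj v)) (at z)"

lemma wirtinger_diff_imp:
  assumes "wirtinger_diff h G D z"
  shows "wirtinger h z = G" "wirtinger_bar h z = D"
proof -
  have "frechet_derivative h (at z) = (\<lambda>v. G * v + D * cnj v)"
    using frechet_derivative_at assms unfolding wirtinger_diff_def by metis
  then show "wirtinger h z = G" "wirtinger_bar h z = D"
    by (simp_all add: wirtinger_def wirtinger_bar_def algebra_simps)
qed

lemma wirtinger_diff_ident: "wirtinger_diff (\<lambda>w. w) 1 0 z"
  by (simp add: wirtinger_diff_def)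

lemma wirtinger_diff_cnj: "wirtinger_diff cnj 0 1 z"
  by (simp add: wirtinger_diff_def bounded_linear_cnj bounded_linear_imp_has_derivative)

lemma wirtinger_diff_add:
  assumes "wirtinger_diff f G D z" "wirtinger_diff g G' D' z"
  shows "wirtinger_diff (\<lambda>w. f w + g w) (G + G') (D + D') z"
  using has_derivative_add[OF assms[unfolded wirtinger_diff_def]]
  unfolding wirtinger_diff_def by (rule has_derivative_eq_rhs) (simp add: fun_eq_iff algebra_simps)

lemma wirtinger_diff_mult:
  assumes "wirtinger_diff f G D z" "wirtinger_diff g G' D' z"
  shows "wirtinger_diff (\<lambda>w. f w * g w) (f z * G' + G * g z) (f z * D' + D * g z) z"
  using has_derivative_mult[OF assms[unfolded wirtinger_diff_def]]
  unfolding wirtinger_diff_def by (rule has_derivative_eq_rhs) (simp add: fun_eq_iff algebra_simps)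

lemma wirtinger_diff_compose:
  assumes g: "(g has_field_derivative g') (at (f z))" and f: "wirtinger_diff f G D z"
  shows "wirtinger_diff (\<lambda>w. g (f w)) (g' * G) (g' * D) z"
  using has_derivative_compose[OF f[unfolded wirtinger_diff_def] has_field_derivative_imp_has_derivative[OF g]]
  unfolding wirtinger_diff_def by (rule has_derivative_eq_rhs) (simp add: fun_eq_iff algebra_simps)

lemma wirtinger_diff_transform:
  assumes "wirtinger_diff f G D z" "open S" "z \<in> S" "\<And>w. w \<in> S \<Longrightarrow> f w = g w"
  shows "wirtinger_diff g G D z"
  using assms unfolding wirtinger_diff_def by (rule has_derivative_transform_within_open)

lemma DERIV_inverse_power_kernel:
  fixes v z :: complex
  assumes nz: "1 - v * z \<noteq> 0"
  shows "((\<lambda>z. inverse (1 - v * z) ^ n) has_field_derivative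
    of_nat n * v * inverse (1 - v * z) ^ (n + 1)) (at z)"
proof (cases n)
  case (Suc m)
  have "((\<lambda>z. inverse (1 - v * z)) has_field_derivative v * inverse (1 - v * z) ^ 2) (at z)"
    using nz by (auto intro!: derivative_eq_intros simp: power2_eq_square)
  from DERIV_power[OF this, of n] show ?thesis
    by (simp add: Suc mult_ac power2_eq_square)
qed simp

text \<open>Both derivatives of such a term are sums of two terms of the same shape, with the pole
  order raised by at most one. The exponents \<open>a - 1\<close> and \<open>b - 1\<close> are
  truncated at 0, harmlessly, because the factor \<open>of_nat a\<close> or \<open>of_nat b\<close>
  is then zero.\<close>

lemma wirtinger_diff_kernel_term:
  assumes w: "w \<in> unit_disk"
  shows "wirtinger_diff (\<lambda>w. c * w ^ a * cnj w ^ b * inverse (1 - cnj w * w) ^ n)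
    (c * of_nat a * w ^ (a - 1) * cnj w ^ b * inverse (1 - cnj w * w) ^ n
      + c * of_nat n * w ^ a * cnj w ^ (b + 1) * inverse (1 - cnj w * w) ^ (n + 1))
    (c * of_nat b * w ^ a * cnj w ^ (b - 1) * inverse (1 - cnj w * w) ^ n
      + c * of_nat n * w ^ (a + 1) * cnj w ^ b * inverse (1 - cnj w * w) ^ (n + 1)) w"
proof -
  have nz: "1 - cnj w * w \<noteq> 0"
    using w by (intro one_minus_mult_neq_0) auto
  have 1: "wirtinger_diff (\<lambda>w. c * w ^ a) (c * (of_nat a * w ^ (a - 1)) * 1) (c * (of_nat a * w ^ (a - 1)) * 0) w"
    by (rule wirtinger_diff_compose[OF _ wirtinger_diff_ident]) (auto intro!: derivative_eq_intros)
  have 2: "wirtinger_diff (\<lambda>w. cnj w ^ b) (of_nat b * cnj w ^ (b - 1) * 0) (of_nat b * cnj w ^ (b - 1) * 1) w"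
    by (rule wirtinger_diff_compose[OF _ wirtinger_diff_cnj]) (auto intro!: derivative_eq_intros)
  have p: "wirtinger_diff (\<lambda>w. cnj w * w) (cnj w * 1 + 0 * w) (cnj w * 0 + 1 * w) w"
    by (rule wirtinger_diff_mult[OF wirtinger_diff_cnj wirtinger_diff_ident])
  have "((\<lambda>x. inverse (1 - x) ^ n) has_field_derivative
      of_nat n * inverse (1 - cnj w * w) ^ (n + 1)) (at (cnj w * w))"
    using DERIV_inverse_power_kernel[of 1 "cnj w * w" n] nz by simp
  from wirtinger_diff_compose[OF this p]
  have 3: "wirtinger_diff (\<lambda>w. inverse (1 - cnj w * w) ^ n)
      (of_nat n * inverse (1 - cnj w * w) ^ (n + 1) * (cnj w * 1 + 0 * w))
      (of_nat n * inverse (1 - cnj w * w) ^ (n + 1) * (cnj w * 0 + 1 * w)) w" .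
  show ?thesis
    using wirtinger_diff_mult[OF wirtinger_diff_mult[OF 1 2] 3]
    by (rule arg_cong2[where f = "\<lambda>G D. wirtinger_diff _ G D _", THEN iffD1, rotated 2])
       (simp_all add: algebra_simps)
qed

text \<open>The variables are independent here; on the diagonal \<open>v = cnj z\<close> the derivative in \<open>z\<close> becomes
  the Wirtinger derivative.\<close>

inductive kernel_comb :: "nat \<Rightarrow> (complex \<Rightarrow> complex \<Rightarrow> complex) \<Rightarrow> bool" where
  kernel_comb_term: "n \<le> m \<Longrightarrow> kernel_comb m (\<lambda>z v. c * z ^ a * v ^ b * inverse (1 - v * z) ^ n)"
| kernel_comb_add: "kernel_comb m F \<Longrightarrow> kernel_comb m G \<Longrightarrow> kernel_comb m (\<lambda>z v. F z v + G z v)"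

text \<open>The point is that one and the same \<open>G\<close> serves both notions of derivative.
  The conjugate coefficient \<open>D\<close> is left unspecified: its existence is needed for
  differentiability, its value is not. The index bounds the order of the pole.\<close>

lemma kernel_comb_deriv:
  assumes "kernel_comb m F"
  shows "\<exists>G. kernel_comb (Suc m) G
    \<and> (\<forall>z\<in>unit_disk. \<forall>v. cmod v \<le> 1 \<longrightarrow> ((\<lambda>z. F z v) has_field_derivative G z v) (at z))
    \<and> (\<forall>w\<in>unit_disk. \<exists>D. wirtinger_diff (\<lambda>w. F w (cnj w)) (G w (cnj w)) D w)"
  using assms
proof induction
  case (kernel_comb_term n m c a b)
  define G where "G = (\<lambda>z v. (c * of_nat a) * z ^ (a - 1) * v ^ b * inverse (1 - v * z) ^ n
    + (c * of_nat n) * z ^ a * v ^ (b + 1) * inverse (1 - v * z) ^ (n + 1))"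
  have "kernel_comb (Suc m) G"
    unfolding G_def using kernel_comb_term
    by (intro kernel_comb.kernel_comb_add kernel_comb.kernel_comb_term) auto
  moreover have "((\<lambda>z. c * z ^ a * v ^ b * inverse (1 - v * z) ^ n) has_field_derivative G z v) (at z)"
    if "z \<in> unit_disk" "cmod v \<le> 1" for z v
  proof -
    have nz: "1 - v * z \<noteq> 0" using that by (intro one_minus_mult_neq_0)
    have "((\<lambda>z. c * z ^ a * v ^ b) has_field_derivative c * (of_nat a * z ^ (a - 1)) * v ^ b) (at z)"
      by (auto intro!: derivative_eq_intros)
    from DERIV_mult[OF this DERIV_inverse_power_kernel[OF nz, of n]] show ?thesis
      by (simp add: G_def mult_ac)
  qed
  moreover have "\<exists>D. wirtinger_diff (\<lambda>w. c * w ^ a * cnj w ^ b * inverse (1 - cnj w * w) ^ n) (G w (cnj w)) D w"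
    if "w \<in> unit_disk" for w
    using wirtinger_diff_kernel_term[OF that, of c a b n] unfolding G_def by blast
  ultimately show ?case by blast
next
  case (kernel_comb_add m F1 F2)
  then obtain G1 G2 where G: "kernel_comb (Suc m) G1" "kernel_comb (Suc m) G2"
    and d: "\<And>z v. z \<in> unit_disk \<Longrightarrow> cmod v \<le> 1 \<Longrightarrow> ((\<lambda>z. F1 z v) has_field_derivative G1 z v) (at z)"
      "\<And>z v. z \<in> unit_disk \<Longrightarrow> cmod v \<le> 1 \<Longrightarrow> ((\<lambda>z. F2 z v) has_field_derivative G2 z v) (at z)"
    and w: "\<And>w. w \<in> unit_disk \<Longrightarrow> \<exists>D. wirtinger_diff (\<lambda>w. F1 w (cnj w)) (G1 w (cnj w)) D w"
      "\<And>w. w \<in> unit_disk \<Longrightarrow> \<exists>D. wirtinger_diff (\<lambda>w. F2 w (cnj w)) (G2 w (cnj w)) D w"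
    by blast
  show ?case
  proof (intro exI[of _ "\<lambda>z v. G1 z v + G2 z v"] conjI ballI allI impI)
    show "kernel_comb (Suc m) (\<lambda>z v. G1 z v + G2 z v)"
      using G by (rule kernel_comb.kernel_comb_add)
    show "((\<lambda>z. F1 z v + F2 z v) has_field_derivative G1 z v + G2 z v) (at z)"
      if "z \<in> unit_disk" "cmod v \<le> 1" for z v
      by (intro DERIV_add d that)
    show "\<exists>D. wirtinger_diff (\<lambda>w. F1 w (cnj w) + F2 w (cnj w)) (G1 w (cnj w) + G2 w (cnj w)) D w"
      if "w \<in> unit_disk" for w
      using w[OF that] wirtinger_diff_add by blast
  qed
qed

text \<open>\<open>G\<close> depends on \<open>F\<close> alone, while \<open>h\<close> ranges over
  all functions that agree with \<open>F\<close> on the diagonal over the disk. As the disk is open,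
  such agreement determines the derivatives there, so \<open>h\<close> may itself be an iterated
  conjugate derivative.\<close>

lemma kernel_comb_higher_deriv:
  assumes F: "kernel_comb m F"
  shows "\<exists>G. kernel_comb (m + k) G
    \<and> (\<forall>z\<in>unit_disk. \<forall>v. cmod v \<le> 1 \<longrightarrow> (deriv ^^ k) (\<lambda>z. F z v) z = G z v)
    \<and> (\<forall>h. (\<forall>w\<in>unit_disk. h w = F w (cnj w)) \<longrightarrow>
          (\<forall>w\<in>unit_disk. (wirtinger ^^ k) h w = G w (cnj w)))"
proof (induction k)
  case 0
  show ?case using F by (intro exI[of _ F]) auto
next
  case (Suc k)
  then obtain G where G: "kernel_comb (m + k) G"
    and d: "\<And>z v. z \<in> unit_disk \<Longrightarrow> cmod v \<le> 1 \<Longrightarrow> (deriv ^^ k) (\<lambda>z. F z v) z = G z v"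
    and w: "\<And>h w. \<forall>w\<in>unit_disk. h w = F w (cnj w) \<Longrightarrow> w \<in> unit_disk \<Longrightarrow>
        (wirtinger ^^ k) h w = G w (cnj w)"
    by blast
  obtain G' where G': "kernel_comb (Suc (m + k)) G'"
    and d': "\<And>z v. z \<in> unit_disk \<Longrightarrow> cmod v \<le> 1 \<Longrightarrow> ((\<lambda>z. G z v) has_field_derivative G' z v) (at z)"
    and w': "\<And>w. w \<in> unit_disk \<Longrightarrow> \<exists>D. wirtinger_diff (\<lambda>w. G w (cnj w)) (G' w (cnj w)) D w"
    using kernel_comb_deriv[OF G] by blast
  show ?case
  proof (intro exI[of _ G'] conjI ballI allI impI)
    show "kernel_comb (m + Suc k) G'" using G' by simp
    fix z v :: complex assume z: "z \<in> unit_disk" and v: "cmod v \<le> 1"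
    have "((deriv ^^ k) (\<lambda>z. F z v) has_field_derivative G' z v) (at z)"
      using has_field_derivative_transform_within_open[OF d'[OF z v] open_ball z] d v by simp
    then show "(deriv ^^ Suc k) (\<lambda>z. F z v) z = G' z v"
      by (simp add: DERIV_imp_deriv)
  next
    fix h w assume h: "\<forall>w\<in>unit_disk. h w = F w (cnj w)" and w0: "w \<in> unit_disk"
    obtain D where "wirtinger_diff (\<lambda>w. G w (cnj w)) (G' w (cnj w)) D w"
      using w'[OF w0] by blast
    then have "wirtinger_diff ((wirtinger ^^ k) h) (G' w (cnj w)) D w"
      by (rule wirtinger_diff_transform[OF _ open_ball w0]) (simp add: w[OF h])
    then show "(wirtinger ^^ Suc k) h w = G' w (cnj w)"
      by (simp add: wirtinger_diff_imp)
  qed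
qed

text \<open>On the diagonal the pole is a power of \<open>1 - (cmod w)\<^sup>2\<close>, which lies
  in (0,1], so terms of lower order are dominated by the order \<open>m\<close>.\<close>

lemma kernel_comb_bound:
  assumes "kernel_comb m F"
  shows "\<exists>C. \<forall>w\<in>unit_disk. cmod (F w (cnj w)) \<le> C * (1 - (cmod w)\<^sup>2) powr (- real m)"
  using assms
proof induction
  case (kernel_comb_term n m c a b)
  have "cmod (c * w ^ a * cnj w ^ b * inverse (1 - cnj w * w) ^ n)
      \<le> cmod c * (1 - (cmod w)\<^sup>2) powr (- real m)" if w: "w \<in> unit_disk" for w
  proof -
    have s: "0 < 1 - (cmod w)\<^sup>2" "1 - (cmod w)\<^sup>2 \<le> 1"
      using w by (simp_all add: power_less_one_iff)
    have "1 - cnj w * w = complex_of_real (1 - (cmod w)\<^sup>2)"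
      by (simp add: complex_norm_square mult.commute del: of_real_power)
    then have "cmod (1 - cnj w * w) = 1 - (cmod w)\<^sup>2"
      using s by (simp only: norm_of_real abs_of_pos)
    then have "cmod (inverse (1 - cnj w * w) ^ n) = (1 - (cmod w)\<^sup>2) powr (- real n)"
      using s by (simp add: norm_power norm_inverse powr_minus powr_realpow power_inverse)
    also have "\<dots> \<le> (1 - (cmod w)\<^sup>2) powr (- real m)"
      using s kernel_comb_term by (intro powr_mono') auto
    finally have "cmod (inverse (1 - cnj w * w) ^ n) \<le> (1 - (cmod w)\<^sup>2) powr (- real m)" .
    moreover have "cmod w ^ a * cmod w ^ b \<le> 1"
      using w by (intro mult_le_one power_le_one) auto
    ultimately have "cmod w ^ a * cmod w ^ b * cmod (inverse (1 - cnj w * w) ^ n)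
        \<le> 1 * (1 - (cmod w)\<^sup>2) powr (- real m)"
      by (intro mult_mono) auto
    then have "cmod c * (cmod w ^ a * cmod w ^ b * cmod (inverse (1 - cnj w * w) ^ n))
        \<le> cmod c * (1 * (1 - (cmod w)\<^sup>2) powr (- real m))"
      by (intro mult_left_mono) auto
    then show ?thesis
      by (simp add: norm_mult norm_power mult.assoc)
  qed
  then show ?case by blast
next
  case (kernel_comb_add m F G)
  then obtain C C' where C: "\<And>w. w \<in> unit_disk \<Longrightarrow> cmod (F w (cnj w)) \<le> C * (1 - (cmod w)\<^sup>2) powr (- real m)"
      "\<And>w. w \<in> unit_disk \<Longrightarrow> cmod (G w (cnj w)) \<le> C' * (1 - (cmod w)\<^sup>2) powr (- real m)"
    by blast
  have "cmod (F w (cnj w) + G w (cnj w)) \<le> (C + C') * (1 - (cmod w)\<^sup>2) powr (- real m)"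
    if "w \<in> unit_disk" for w
    using norm_triangle_ineq[of "F w (cnj w)" "G w (cnj w)"] C[OF that] by (simp add: distrib_right)
  then show ?case by blast
qed

lemma kernel_comb_continuous:
  assumes "kernel_comb m F"
  shows "continuous_on unit_disk (\<lambda>w. F w (cnj w))"
  using assms
proof induction
  case (kernel_comb_term n m c a b)
  show ?case
    using one_minus_mult_neq_0[of "cnj w" w for w] by (auto intro!: continuous_intros)
qed (auto intro!: continuous_intros)

text \<open>No power of \<open>cnj w\<close> stands in the numerator, so each conjugate derivative
  falls on the pole and a single term survives. The factor \<open>cnj w ^ 0\<close> keeps the
  expression in the shape of a kernel term.\<close>

lemma higher_wirtinger_bar:
  assumes h: "\<And>w. w \<in> unit_disk \<Longrightarrow> h w = 1 / (1 - w * cnj w)\<^sup>2" and w: "w \<in> unit_disk"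
  shows "(wirtinger_bar ^^ k) h w = fact (k + 1) * w ^ k * cnj w ^ 0 * inverse (1 - cnj w * w) ^ (k + 2)"
  using w
proof (induction k arbitrary: w)
  case 0
  then show ?case by (simp add: h power_inverse power2_eq_square inverse_eq_divide mult.commute)
next
  case (Suc k)
  have "wirtinger_diff ((wirtinger_bar ^^ k) h)
    (fact (k + 1) * of_nat k * w ^ (k - 1) * cnj w ^ 0 * inverse (1 - cnj w * w) ^ (k + 2)
      + fact (k + 1) * of_nat (k + 2) * w ^ k * cnj w ^ (0 + 1) * inverse (1 - cnj w * w) ^ (k + 2 + 1))
    (fact (k + 1) * of_nat 0 * w ^ k * cnj w ^ (0 - 1) * inverse (1 - cnj w * w) ^ (k + 2)
      + fact (k + 1) * of_nat (k + 2) * w ^ (k + 1) * cnj w ^ 0 * inverse (1 - cnj w * w) ^ (k + 2 + 1)) w"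
    by (rule wirtinger_diff_transform[OF wirtinger_diff_kernel_term[OF Suc.prems] open_ball Suc.prems])
       (rule Suc.IH [symmetric])
  from wirtinger_diff_imp(2)[OF this] show ?case
    by (simp add: algebra_simps)
qed

text \<open>The squared norm is the reproducing formula applied to \<open>deriv_kernel k w\<close>
  itself. Handing out \<open>G\<close>, not merely the equality, also provides continuity and growth
  of the norm in \<open>w\<close>.\<close>

lemma deriv_kernel_norm_kernel_comb:
  "\<exists>G. kernel_comb (2 * k + 2) G
    \<and> (\<forall>w\<in>unit_disk. G w (cnj w) = complex_of_real ((bergman_norm (deriv_kernel k w))\<^sup>2))
    \<and> (\<forall>h. (\<forall>w\<in>unit_disk. h w = 1 / (1 - w * cnj w)\<^sup>2) \<longrightarrow>
        (\<forall>w\<in>unit_disk. (wirtinger ^^ k) ((wirtinger_bar ^^ k) h) w = G w (cnj w)))"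
proof -
  \<comment> \<open>This function plays two roles: \<open>F z (cnj w)\<close> is
    \<open>deriv_kernel k w z\<close>, and \<open>F w (cnj w)\<close> is the \<open>k\<close>-th
    conjugate derivative of the function in the pairing. Its pole order \<open>k + 2\<close> grows
    to \<open>2 * k + 2\<close>.\<close>
  define F :: "complex \<Rightarrow> complex \<Rightarrow> complex" where
    "F = (\<lambda>z v. fact (k + 1) * z ^ k * v ^ 0 * inverse (1 - v * z) ^ (k + 2))"
  have "kernel_comb (k + 2) F"
    unfolding F_def by (rule kernel_comb_term) simp
  from kernel_comb_higher_deriv[OF this, of k] obtain G where G: "kernel_comb (k + 2 + k) G"
    and d: "\<And>z v. z \<in> unit_disk \<Longrightarrow> cmod v \<le> 1 \<Longrightarrow> (deriv ^^ k) (\<lambda>z. F z v) z = G z v"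
    and w: "\<And>h w. \<forall>w\<in>unit_disk. h w = F w (cnj w) \<Longrightarrow> w \<in> unit_disk \<Longrightarrow>
        (wirtinger ^^ k) h w = G w (cnj w)"
    by blast
  have "kernel_comb (2 * k + 2) G" using G by (simp add: mult_2 add_ac)
  moreover have "G w (cnj w) = complex_of_real ((bergman_norm (deriv_kernel k w))\<^sup>2)"
    if w0: "w \<in> unit_disk" for w
  proof -
    have eq: "deriv_kernel k w z = F z (cnj w)" if "z \<in> unit_disk" for z
      using that by (simp add: deriv_kernel_def F_def power_inverse inverse_eq_divide power_one_over)
    have "deriv_kernel k w holomorphic_on unit_disk"
      using deriv_kernel_bergman[OF w0] by (rule bergmanD)
    moreover from this have "(\<lambda>z. F z (cnj w)) holomorphic_on unit_disk"
      by (rule holomorphic_transform) (rule eq)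
    ultimately have "(deriv ^^ k) (deriv_kernel k w) w = (deriv ^^ k) (\<lambda>z. F z (cnj w)) w"
      using w0 eq by (intro higher_deriv_transform_within_open[where S = unit_disk]) auto
    also have "\<dots> = G w (cnj w)" using w0 by (intro d) auto
    finally show ?thesis
      using reproducing_deriv_kernel[OF deriv_kernel_bergman[OF w0] w0, of k k]
      by (simp add: bergman_inner_self)
  qed
  moreover have "(wirtinger ^^ k) ((wirtinger_bar ^^ k) h) w = G w (cnj w)"
    if "\<forall>w\<in>unit_disk. h w = 1 / (1 - w * cnj w)\<^sup>2" "w \<in> unit_disk" for h w
    using that higher_wirtinger_bar[of h _ k] by (intro w) (auto simp: F_def)
  ultimately show ?thesis by blast
qed

section \<open>Toeplitz operator and trace\<close>

text \<open>Translates unordered sums into integrals over counting measure, so that Tonelli applies.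
  One direction feeds in Parseval's identity, the other reads off the diagonal sum.\<close>

lemma nn_integral_count_space_eq_iff_has_sum:
  fixes f :: "'a \<Rightarrow> real"
  assumes f: "\<And>x. x \<in> A \<Longrightarrow> 0 \<le> f x" and s: "0 \<le> s"
  shows "(\<integral>\<^sup>+ x. ennreal (f x) \<partial>count_space A) = ennreal s \<longleftrightarrow> (f has_sum s) A"
proof
  assume "(f has_sum s) A"
  then have "f summable_on A" "infsum f A = s"
    by (auto intro: has_sum_imp_summable infsumI)
  then have "Infinite_Set_Sum.abs_summable_on f A"
    by (simp only: abs_summable_equivalent [symmetric] summable_on_iff_abs_summable_on_real [symmetric])
  from nn_integral_conv_infsetsum[OF this f] infsetsum_infsum[OF this] \<open>infsum f A = s\<close>
  show "(\<integral>\<^sup>+ x. ennreal (f x) \<partial>count_space A) = ennreal s" by simp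
next
  assume *: "(\<integral>\<^sup>+ x. ennreal (f x) \<partial>count_space A) = ennreal s"
  then have "Infinite_Set_Sum.abs_summable_on f A" "infsetsum f A = s"
    unfolding abs_summable_on_def infsetsum_def
    using nn_integral_eq_integrable[of f "count_space A" s] f s by (auto simp: AE_count_space)
  then have "infsum f A = s" "f summable_on A"
    using infsetsum_infsum[of f A]
    by (simp_all only: abs_summable_equivalent [symmetric] summable_on_iff_abs_summable_on_real [symmetric])
  then show "(f has_sum s) A"
    using has_sum_infsum by blast
qed

section \<open>Integrability under the weight condition\<close>

locale trace_measure =
  fixes k :: nat and \<mu> :: "complex measure"
  assumes sets_\<mu>: "sets \<mu> = sets (restrict_space borel unit_disk)"
    and weight: "(\<integral>\<^sup>+ w. ennreal ((1 - (cmod w)\<^sup>2) powr (- 2 - 2 * real k)) \<partial>\<mu>) < \<infinity>"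
begin

abbreviation K :: "complex \<Rightarrow> complex \<Rightarrow> complex" where
  "K \<equiv> deriv_kernel k"

abbreviation T :: "(complex \<Rightarrow> complex) \<Rightarrow> complex \<Rightarrow> complex" where
  "T \<equiv> toeplitz k k \<mu>"

text \<open>Before it is identified as the trace, this number is the squared norm of the kernel on
  the product space and a bound for \<open>T\<close>.\<close>

definition trace_value :: real where
  "trace_value = (LINT w|\<mu>. (bergman_norm (K w))\<^sup>2)"

lemma space_\<mu>: "space \<mu> = unit_disk"
  using sets_eq_imp_space_eq[OF sets_\<mu>] by (simp add: space_restrict_space)

lemma measurable_\<mu>: "continuous_on unit_disk f \<Longrightarrow> f \<in> borel_measurable \<mu>"
  for f :: "complex \<Rightarrow> 'a::topological_space"
  by (rule borel_measurable_continuous_on_disk[OF sets_\<mu>])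

lemma weight_measurable: "(\<lambda>w. (1 - (cmod w)\<^sup>2) powr (- 2 - 2 * real k)) \<in> borel_measurable \<mu>"
proof -
  have "1 - (cmod w)\<^sup>2 \<noteq> 0" if "w \<in> unit_disk" for w
    using that power_less_one_iff[of "cmod w" 2] by simp
  then show ?thesis by (intro measurable_\<mu> continuous_intros) auto
qed

lemma weight_integrable: "integrable \<mu> (\<lambda>w. (1 - (cmod w)\<^sup>2) powr (- 2 - 2 * real k))"
  using weight by (intro integrableI_nonneg weight_measurable) auto

text \<open>The weight is at least 1 on the disk. Finiteness makes Fubini applicable and lets square
  integrability of a derivative imply its integrability.\<close>

lemma finite_measure_\<mu>: "finite_measure \<mu>"
proof (rule finite_measureI)
  have "1 \<le> (1 - (cmod w)\<^sup>2) powr (- 2 - 2 * real k)" if "w \<in> unit_disk" for w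
  proof -
    have "(1 - (cmod w)\<^sup>2) powr 0 \<le> (1 - (cmod w)\<^sup>2) powr (- 2 - 2 * real k)"
      using that by (intro powr_mono') (auto simp: power_le_one)
    moreover have "(cmod w)\<^sup>2 < 1" using that by (simp add: power_less_one_iff)
    ultimately show ?thesis by simp
  qed
  then have "(\<integral>\<^sup>+ w. 1 \<partial>\<mu>) \<le> (\<integral>\<^sup>+ w. ennreal ((1 - (cmod w)\<^sup>2) powr (- 2 - 2 * real k)) \<partial>\<mu>)"
    by (intro nn_integral_mono) (simp add: space_\<mu> ennreal_leI flip: ennreal_1)
  then show "emeasure \<mu> (space \<mu>) \<noteq> \<infinity>"
    using weight by (auto simp: top_unique)
qed

sublocale finite_measure \<mu>
  by (rule finite_measure_\<mu>)

sublocale P: pair_sigma_finite \<mu> disk_area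
  by unfold_locales

text \<open>The pole order \<open>2 * k + 2\<close> of the squared norm is exactly the exponent of
  the weight.\<close>

lemma norm_K_integrable: "integrable \<mu> (\<lambda>w. (bergman_norm (K w))\<^sup>2)"
proof -
  obtain G where G: "kernel_comb (2 * k + 2) G"
    and eq: "\<And>w. w \<in> unit_disk \<Longrightarrow> G w (cnj w) = complex_of_real ((bergman_norm (K w))\<^sup>2)"
    using deriv_kernel_norm_kernel_comb[of k] by blast
  obtain C where C: "\<And>w. w \<in> unit_disk \<Longrightarrow>
      cmod (G w (cnj w)) \<le> C * (1 - (cmod w)\<^sup>2) powr (- real (2 * k + 2))"
    using kernel_comb_bound[OF G] by blast
  have e: "- real (2 * k + 2) = - 2 - 2 * real k" by simp
  show ?thesis
  proof (rule Bochner_Integration.integrable_bound)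
    show "integrable \<mu> (\<lambda>w. C * (1 - (cmod w)\<^sup>2) powr (- 2 - 2 * real k))"
      using weight_integrable by simp
    have "continuous_on unit_disk (\<lambda>w. Re (G w (cnj w)))"
      by (intro continuous_intros kernel_comb_continuous[OF G])
    then have "continuous_on unit_disk (\<lambda>w. (bergman_norm (K w))\<^sup>2)"
      by (rule continuous_on_eq) (simp add: eq)
    then show "(\<lambda>w. (bergman_norm (K w))\<^sup>2) \<in> borel_measurable \<mu>"
      by (rule measurable_\<mu>)
    show "AE w in \<mu>. norm ((bergman_norm (K w))\<^sup>2)
        \<le> norm (C * (1 - (cmod w)\<^sup>2) powr (- 2 - 2 * real k))"
    proof (rule AE_I2)
      fix w assume "w \<in> space \<mu>"
      then have w: "w \<in> unit_disk" by (simp add: space_\<mu>)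
      have "norm ((bergman_norm (K w))\<^sup>2) = cmod (G w (cnj w))"
        unfolding eq[OF w] by (simp only: norm_of_real real_norm_def)
      also have "\<dots> \<le> C * (1 - (cmod w)\<^sup>2) powr (- 2 - 2 * real k)"
        using C[OF w] unfolding e .
      finally show "norm ((bergman_norm (K w))\<^sup>2)
        \<le> norm (C * (1 - (cmod w)\<^sup>2) powr (- 2 - 2 * real k))"
        by simp
    qed
  qed
qed

lemma trace_value_nonneg: "0 \<le> trace_value"
  by (simp add: trace_value_def)

lemma deriv_measurable:
  assumes "f \<in> bergman"
  shows "(deriv ^^ k) f \<in> borel_measurable \<mu>"
  using assms
  by (intro measurable_\<mu> holomorphic_on_imp_continuous_on holomorphic_higher_deriv open_ball bergmanD)

lemma deriv_square_le:
  assumes f: "f \<in> bergman" and w: "w \<in> unit_disk"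
  shows "(cmod ((deriv ^^ k) f w))\<^sup>2 \<le> (bergman_norm f)\<^sup>2 * (bergman_norm (K w))\<^sup>2"
  using power_mono[OF higher_deriv_bound[OF f w, of k], of 2] by (simp add: power_mult_distrib)

lemma deriv_square_integrable:
  assumes f: "f \<in> bergman"
  shows "integrable \<mu> (\<lambda>w. (cmod ((deriv ^^ k) f w))\<^sup>2)"
proof (rule Bochner_Integration.integrable_bound)
  show "integrable \<mu> (\<lambda>w. (bergman_norm f)\<^sup>2 * (bergman_norm (K w))\<^sup>2)"
    using norm_K_integrable by simp
  show "(\<lambda>w. (cmod ((deriv ^^ k) f w))\<^sup>2) \<in> borel_measurable \<mu>"
    using deriv_measurable[OF f] by measurable
  show "AE w in \<mu>. norm ((cmod ((deriv ^^ k) f w))\<^sup>2)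
      \<le> norm ((bergman_norm f)\<^sup>2 * (bergman_norm (K w))\<^sup>2)"
    using deriv_square_le[OF f] by (intro AE_I2) (simp add: space_\<mu> abs_of_nonneg)
qed

lemma integral_deriv_square_le:
  assumes f: "f \<in> bergman"
  shows "(LINT w|\<mu>. (cmod ((deriv ^^ k) f w))\<^sup>2) \<le> (bergman_norm f)\<^sup>2 * trace_value"
proof -
  have "(LINT w|\<mu>. (cmod ((deriv ^^ k) f w))\<^sup>2)
      \<le> (LINT w|\<mu>. (bergman_norm f)\<^sup>2 * (bergman_norm (K w))\<^sup>2)"
    using deriv_square_integrable[OF f] norm_K_integrable deriv_square_le[OF f]
    by (intro integral_mono) (auto simp: space_\<mu>)
  then show ?thesis by (simp add: trace_value_def)
qed

lemma bergman_kernel_bergman: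
  assumes "z \<in> unit_disk"
  shows "bergman_kernel z \<in> bergman"
proof -
  have "bergman_kernel z = deriv_kernel 0 z"
    by (auto simp: fun_eq_iff bergman_kernel_def deriv_kernel_def power2_eq_square)
  then show ?thesis using deriv_kernel_bergman[OF assms, of 0] by simp
qed

lemma toeplitz_form_eq:
  "toeplitz_form k k \<mu> f g = (LINT w|\<mu>. (deriv ^^ k) f w * cnj ((deriv ^^ k) g w))"
  by (simp add: toeplitz_form_def flip: mult_2)

lemma toeplitz_eq:
  assumes z: "z \<in> unit_disk"
  shows "T f z = (LINT w|\<mu>. (deriv ^^ k) f w * K w z)"
  unfolding toeplitz_def toeplitz_form_eq using z
  by (auto simp: space_\<mu> higher_deriv_bergman_kernel intro!: Bochner_Integration.integral_cong)

text \<open>For fixed \<open>z\<close> this is, up to conjugation, the \<open>k\<close>-th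
  derivative of the Bergman function \<open>bergman_kernel z\<close>, so the general facts on
  derivatives apply.\<close>

lemma K_measurable_left:
  assumes z: "z \<in> unit_disk"
  shows "(\<lambda>w. K w z) \<in> borel_measurable \<mu>" "integrable \<mu> (\<lambda>w. (cmod (K w z))\<^sup>2)"
proof -
  note b = bergman_kernel_bergman[OF z]
  have "(\<lambda>w. cnj ((deriv ^^ k) (bergman_kernel z) w)) \<in> borel_measurable \<mu>"
    using deriv_measurable[OF b] by measurable
  then show "(\<lambda>w. K w z) \<in> borel_measurable \<mu>"
    by (rule measurable_cong[THEN iffD1, rotated])
       (simp add: space_\<mu> higher_deriv_bergman_kernel[OF z])
  show "integrable \<mu> (\<lambda>w. (cmod (K w z))\<^sup>2)"
    using deriv_square_integrable[OF b]
    by (rule Bochner_Integration.integrable_cong[THEN iffD1, rotated 2])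
       (simp_all add: space_\<mu> higher_deriv_bergman_kernel[OF z])
qed

lemma K_measurable: "(\<lambda>x. K (fst x) (snd x)) \<in> borel_measurable (\<mu> \<Otimes>\<^sub>M disk_area)"
proof -
  have "(\<lambda>w. w) \<in> borel_measurable \<mu>" "(\<lambda>z. z) \<in> borel_measurable disk_area"
    by (auto intro!: measurable_\<mu> borel_measurable_disk_area continuous_intros)
  then have [measurable]: "fst \<in> borel_measurable (\<mu> \<Otimes>\<^sub>M disk_area)"
    "snd \<in> borel_measurable (\<mu> \<Otimes>\<^sub>M disk_area)"
    using measurable_compose[OF measurable_fst[of \<mu> disk_area]]
      measurable_compose[OF measurable_snd[of \<mu> disk_area]] by blast+
  have "(\<lambda>x. fact (k + 1) * snd x ^ k / (1 - cnj (fst x) * snd x) ^ (k + 2))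
      \<in> borel_measurable (\<mu> \<Otimes>\<^sub>M disk_area)"
    by measurable
  then show ?thesis
    by (rule measurable_cong[THEN iffD1, rotated])
       (auto simp: deriv_kernel_def space_pair_measure)
qed

lemma K_square_integrable: "integrable (\<mu> \<Otimes>\<^sub>M disk_area) (\<lambda>x. (cmod (K (fst x) (snd x)))\<^sup>2)"
proof (rule P.Fubini_integrable)
  show "(\<lambda>x. (cmod (K (fst x) (snd x)))\<^sup>2) \<in> borel_measurable (\<mu> \<Otimes>\<^sub>M disk_area)"
    using K_measurable by measurable
  show "integrable \<mu> (\<lambda>w. LINT z|disk_area. norm ((cmod (K (fst (w, z)) (snd (w, z))))\<^sup>2))"
    using norm_K_integrable by (simp add: bergman_norm_square)
  show "AE w in \<mu>. integrable disk_area (\<lambda>z. (cmod (K (fst (w, z)) (snd (w, z))))\<^sup>2)"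
    using bergmanD(2)[OF deriv_kernel_bergman] by (intro AE_I2) (simp add: space_\<mu>)
qed

text \<open>The area integral of the squared kernel is \<open>(bergman_norm (K w))\<^sup>2\<close>;
  Fubini transfers this to the other order of integration.\<close>

lemma K_square_integrable_right:
  "integrable disk_area (\<lambda>z. LINT w|\<mu>. (cmod (K w z))\<^sup>2)"
  "(LINT z|disk_area. LINT w|\<mu>. (cmod (K w z))\<^sup>2) = trace_value"
proof -
  have i: "integrable (\<mu> \<Otimes>\<^sub>M disk_area) (case_prod (\<lambda>w z. (cmod (K w z))\<^sup>2))"
    using K_square_integrable by (simp add: case_prod_beta')
  show "integrable disk_area (\<lambda>z. LINT w|\<mu>. (cmod (K w z))\<^sup>2)"
    by (rule P.integrable_snd[OF i])
  show "(LINT z|disk_area. LINT w|\<mu>. (cmod (K w z))\<^sup>2) = trace_value"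
    using P.Fubini_integral[OF i] by (simp add: trace_value_def bergman_norm_square)
qed

section \<open>The operator on the Bergman space\<close>

text \<open>Expanding \<open>K w z\<close> in powers of \<open>z\<close> and integrating term by
  term against \<open>\<mu>\<close> exhibits \<open>T f\<close> as a power series on the
  disk.\<close>

lemma toeplitz_holomorphic:
  assumes f: "f \<in> bergman"
  shows "T f holomorphic_on unit_disk"
proof -
  note [measurable] = deriv_measurable[OF f]
  define b where "b = (\<lambda>m. LINT w|\<mu>. (deriv ^^ k) f w * cnj w ^ m)"
  \<comment> \<open>\<open>K w z\<close> contains the factor \<open>z ^ k\<close>, so the series of
    \<open>T f\<close> starts at degree \<open>k\<close>; lower coefficients are filled in by
    0.\<close>
  define a where "a = (\<lambda>n. if n < k then 0 else fact (n + 1) / fact (n - k) * b (n - k))"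
  have id [measurable]: "(\<lambda>w. w) \<in> borel_measurable \<mu>"
    by (auto intro!: measurable_\<mu> continuous_intros)
  have intf: "integrable \<mu> ((deriv ^^ k) f)"
    using integrable_mult_of_square_integrable[of "(deriv ^^ k) f" \<mu> "\<lambda>_. 1"]
      deriv_square_integrable[OF f] by simp
  have "(\<lambda>n. a n * (z - 0) ^ n) sums T f z" if z: "z \<in> unit_disk" for z
  proof -
    define r where "r = (\<lambda>m. fact (k + m + 1) / fact m * cmod z ^ m)"
    have r: "summable r" "0 \<le> r m" for m
      unfolding r_def using z by (intro summable_kernel) auto
    define F where "F = (\<lambda>m w. (fact (k + m + 1) / fact m * z ^ (k + m)) * ((deriv ^^ k) f w * cnj w ^ m))"
    have bound: "norm (F m w) \<le> r m * cmod ((deriv ^^ k) f w)" if "w \<in> unit_disk" for m w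
    proof -
      have "cmod w ^ m \<le> 1" "cmod z ^ k \<le> 1"
        using that z by (auto intro!: power_le_one)
      then have "cmod z ^ k * cmod w ^ m \<le> 1"
        by (intro mult_le_one) auto
      then have "r m * cmod ((deriv ^^ k) f w) * (cmod z ^ k * cmod w ^ m)
          \<le> r m * cmod ((deriv ^^ k) f w) * 1"
        using r(2) by (intro mult_left_mono) auto
      then show ?thesis
        by (simp add: F_def r_def norm_mult norm_divide norm_power power_add mult_ac del: fact_Suc)
    qed
    have Fm: "F m \<in> borel_measurable \<mu>" for m
      unfolding F_def by measurable
    have Fi: "integrable \<mu> (F m)" for m
      by (rule Bochner_Integration.integrable_bound[OF _ Fm AE_I2, of "\<lambda>w. r m * cmod ((deriv ^^ k) f w)"])
         (use intf bound r in \<open>auto simp: space_\<mu> abs_mult\<close>)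
    have "(\<lambda>m. LINT w|\<mu>. F m w) sums (LINT w|\<mu>. (\<Sum>m. F m w))"
    proof (rule sums_integral[OF Fi AE_I2])
      fix w assume "w \<in> space \<mu>"
      then show "summable (\<lambda>m. norm (F m w))"
        using bound
        by (intro summable_comparison_test'[OF summable_mult2[OF r(1), of "cmod ((deriv ^^ k) f w)"], of 0])
           (auto simp: space_\<mu>)
    next
      have "(LINT w|\<mu>. norm (F m w)) \<le> r m * (LINT w|\<mu>. cmod ((deriv ^^ k) f w))" for m
      proof -
        have "(LINT w|\<mu>. norm (F m w)) \<le> (LINT w|\<mu>. r m * cmod ((deriv ^^ k) f w))"
          using Fi intf bound by (intro integral_mono) (auto simp: space_\<mu>)
        then show ?thesis by simp
      qed
      then show "summable (\<lambda>m. LINT w|\<mu>. norm (F m w))"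
        by (intro summable_comparison_test'[OF summable_mult2[OF r(1), of "LINT w|\<mu>. cmod ((deriv ^^ k) f w)"], of 0])
           simp
    qed
    also have "(LINT w|\<mu>. (\<Sum>m. F m w)) = T f z"
      unfolding toeplitz_eq[OF z]
    proof (rule Bochner_Integration.integral_cong[OF refl])
      fix w assume "w \<in> space \<mu>"
      then have w: "w \<in> unit_disk" by (simp add: space_\<mu>)
      have "(\<lambda>m. (deriv ^^ k) f w * (fact (k + m + 1) / fact m * z ^ (k + m) * cnj w ^ m)) sums
          ((deriv ^^ k) f w * (fact (k + 1) * z ^ k / (1 - z * cnj w) ^ (k + 2)))"
        using w z by (intro sums_mult sums_kernel) auto
      moreover have "(deriv ^^ k) f w * (fact (k + m + 1) / fact m * z ^ (k + m) * cnj w ^ m) = F m w" for m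
        by (simp add: F_def mult_ac)
      ultimately show "(\<Sum>m. F m w) = (deriv ^^ k) f w * K w z"
        using z by (simp add: sums_iff deriv_kernel_def mult.commute)
    qed
    also have "(\<lambda>m. LINT w|\<mu>. F m w) = (\<lambda>m. a (m + k) * (z - 0) ^ (m + k))"
      unfolding F_def a_def b_def by (simp only: integral_mult_right_zero) (simp add: mult_ac add_ac)
    finally show ?thesis
      by (subst (asm) sums_zero_iff_shift) (simp_all add: a_def)
  qed
  then show ?thesis by (rule power_series_holomorphic)
qed

lemma toeplitz_square_le:
  assumes f: "f \<in> bergman" and z: "z \<in> unit_disk"
  shows "(cmod (T f z))\<^sup>2 \<le> (LINT w|\<mu>. (cmod ((deriv ^^ k) f w))\<^sup>2) * (LINT w|\<mu>. (cmod (K w z))\<^sup>2)"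
proof -
  have "cmod (T f z) \<le> (LINT w|\<mu>. cmod ((deriv ^^ k) f w * K w z))"
    unfolding toeplitz_eq[OF z] by (rule integral_norm_bound)
  then have "(cmod (T f z))\<^sup>2 \<le> (LINT w|\<mu>. cmod ((deriv ^^ k) f w * K w z))\<^sup>2"
    by (rule power_mono) simp
  also have "\<dots> \<le> (LINT w|\<mu>. (cmod ((deriv ^^ k) f w))\<^sup>2) * (LINT w|\<mu>. (cmod (K w z))\<^sup>2)"
    by (intro integral_Cauchy_Schwarz deriv_measurable deriv_square_integrable f K_measurable_left z)
  finally show ?thesis .
qed

text \<open>Integrates the pointwise Cauchy-Schwarz bound over the disk. \<open>trace_value\<close>
  enters twice, from the kernel and from the integral of the squared derivative of \<open>f\<close>,
  so it is the constant once roots are taken.\<close>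

lemma toeplitz_bergman:
  assumes f: "f \<in> bergman"
  shows "T f \<in> bergman" "bergman_norm (T f) \<le> trace_value * bergman_norm f"
proof -
  define A where "A = (LINT w|\<mu>. (cmod ((deriv ^^ k) f w))\<^sup>2)"
  have A: "0 \<le> A" by (simp add: A_def)
  have m: "T f \<in> borel_measurable disk_area"
    using toeplitz_holomorphic[OF f]
    by (intro borel_measurable_continuous_on_disk sets_disk_area holomorphic_on_imp_continuous_on)
  have i: "integrable disk_area (\<lambda>z. A * (LINT w|\<mu>. (cmod (K w z))\<^sup>2))"
    using K_square_integrable_right(1) by simp
  have le: "(cmod (T f z))\<^sup>2 \<le> A * (LINT w|\<mu>. (cmod (K w z))\<^sup>2)" if "z \<in> unit_disk" for z
    using toeplitz_square_le[OF f that] by (simp add: A_def)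
  have int: "integrable disk_area (\<lambda>z. (cmod (T f z))\<^sup>2)"
  proof (rule Bochner_Integration.integrable_bound[OF i])
    show "(\<lambda>z. (cmod (T f z))\<^sup>2) \<in> borel_measurable disk_area"
      using m by measurable
    show "AE z in disk_area. norm ((cmod (T f z))\<^sup>2) \<le> norm (A * (LINT w|\<mu>. (cmod (K w z))\<^sup>2))"
      using le A by (intro AE_I2) (simp add: abs_of_nonneg)
  qed
  then show "T f \<in> bergman"
    using toeplitz_holomorphic[OF f] by (simp add: bergman_def toeplitz_def)
  have "(bergman_norm (T f))\<^sup>2 \<le> (LINT z|disk_area. A * (LINT w|\<mu>. (cmod (K w z))\<^sup>2))"
    unfolding bergman_norm_square using int i le by (intro integral_mono) auto
  also have "\<dots> = A * trace_value"
    by (simp add: K_square_integrable_right)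
  also have "\<dots> \<le> ((bergman_norm f)\<^sup>2 * trace_value) * trace_value"
    unfolding A_def using trace_value_nonneg by (intro mult_right_mono integral_deriv_square_le f)
  also have "\<dots> = (trace_value * bergman_norm f)\<^sup>2"
    by (simp add: power2_eq_square mult_ac)
  finally show "bergman_norm (T f) \<le> trace_value * bergman_norm f"
    by (rule power2_le_imp_le) (simp add: trace_value_nonneg bergman_norm_nonneg)
qed

lemma toeplitz_inner:
  assumes f: "f \<in> bergman" and g: "g \<in> bergman"
  shows "bergman_inner (T f) g = (LINT w|\<mu>. (deriv ^^ k) f w * cnj ((deriv ^^ k) g w))"
proof -
  define H where "H = (\<lambda>w z. (deriv ^^ k) f w * (K w z * cnj (g z)))"
  have Hm: "case_prod H \<in> borel_measurable (\<mu> \<Otimes>\<^sub>M disk_area)"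
  proof -
    have [measurable]: "(\<lambda>x. (deriv ^^ k) f (fst x)) \<in> borel_measurable (\<mu> \<Otimes>\<^sub>M disk_area)"
      "(\<lambda>x. g (snd x)) \<in> borel_measurable (\<mu> \<Otimes>\<^sub>M disk_area)"
      by (rule measurable_compose[OF measurable_fst deriv_measurable[OF f]]
          measurable_compose[OF measurable_snd bergmanD(4)[OF g]])+
    note [measurable] = K_measurable
    show ?thesis unfolding H_def case_prod_beta' by measurable
  qed
  have inner: "integrable disk_area (\<lambda>z. K w z * cnj (g z))" if "w \<in> unit_disk" for w
    by (intro bergman_integrable_inner deriv_kernel_bergman that g)
  have HI: "integrable (\<mu> \<Otimes>\<^sub>M disk_area) (case_prod H)"
  proof (rule P.Fubini_integrable[OF Hm])
    show "AE w in \<mu>. integrable disk_area (\<lambda>z. case_prod H (w, z))"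
      using inner by (intro AE_I2) (simp add: space_\<mu> H_def)
    show "integrable \<mu> (\<lambda>w. LINT z|disk_area. norm (case_prod H (w, z)))"
    proof (rule Bochner_Integration.integrable_bound)
      \<comment> \<open>One factor \<open>bergman_norm (K w)\<close> comes from the bound on the
        derivative of \<open>f\<close> at \<open>w\<close>, the other from Cauchy-Schwarz for
        \<open>K w\<close> and \<open>g\<close>.\<close>
      show "integrable \<mu> (\<lambda>w. bergman_norm f * bergman_norm g * (bergman_norm (K w))\<^sup>2)"
        using norm_K_integrable by simp
      show "(\<lambda>w. LINT z|disk_area. norm (case_prod H (w, z))) \<in> borel_measurable \<mu>"
        using Hm by (intro disk_area.borel_measurable_lebesgue_integral) (simp add: case_prod_beta')
      show "AE w in \<mu>. norm (LINT z|disk_area. norm (case_prod H (w, z)))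
          \<le> norm (bergman_norm f * bergman_norm g * (bergman_norm (K w))\<^sup>2)"
      proof (rule AE_I2)
        fix w assume "w \<in> space \<mu>"
        then have w: "w \<in> unit_disk" by (simp add: space_\<mu>)
        have "(LINT z|disk_area. norm (case_prod H (w, z)))
            = cmod ((deriv ^^ k) f w) * (LINT z|disk_area. cmod (K w z * cnj (g z)))"
          by (simp add: H_def norm_mult)
        also have "\<dots> \<le> (bergman_norm f * bergman_norm (K w)) * (bergman_norm (K w) * bergman_norm g)"
          by (intro mult_mono higher_deriv_bound bergman_Cauchy_Schwarz_integral
              deriv_kernel_bergman f g w) (auto simp: bergman_norm_nonneg)
        also have "\<dots> = bergman_norm f * bergman_norm g * (bergman_norm (K w))\<^sup>2"
          by (simp add: power2_eq_square mult_ac)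
        finally show "norm (LINT z|disk_area. norm (case_prod H (w, z)))
          \<le> norm (bergman_norm f * bergman_norm g * (bergman_norm (K w))\<^sup>2)"
          by (simp add: bergman_norm_nonneg abs_of_nonneg)
      qed
    qed
  qed
  have "bergman_inner (T f) g = (LINT z|disk_area. LINT w|\<mu>. H w z)"
    unfolding bergman_inner_def
    by (rule Bochner_Integration.integral_cong)
       (simp_all add: toeplitz_eq H_def mult.assoc flip: integral_mult_left_zero)
  also have "\<dots> = (LINT w|\<mu>. LINT z|disk_area. H w z)"
    by (rule P.Fubini_integral[OF HI])
  also have "\<dots> = (LINT w|\<mu>. (deriv ^^ k) f w * cnj ((deriv ^^ k) g w))"
  proof (rule Bochner_Integration.integral_cong[OF refl])
    fix w assume "w \<in> space \<mu>"
    then have w: "w \<in> unit_disk" by (simp add: space_\<mu>)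
    have "(LINT z|disk_area. H w z) = (deriv ^^ k) f w * bergman_inner (K w) g"
      by (simp add: H_def bergman_inner_def)
    also have "bergman_inner (K w) g = cnj ((deriv ^^ k) g w)"
      by (subst bergman_inner_cnj [symmetric]) (simp add: reproducing_deriv_kernel[OF g w])
    finally show "(LINT z|disk_area. H w z) = (deriv ^^ k) f w * cnj ((deriv ^^ k) g w)" .
  qed
  finally show ?thesis .
qed

lemma toeplitz_inner_self:
  assumes "f \<in> bergman"
  shows "bergman_inner (T f) f = complex_of_real (LINT w|\<mu>. (cmod ((deriv ^^ k) f w))\<^sup>2)"
  unfolding toeplitz_inner[OF assms assms]
  by (simp add: complex_norm_square [symmetric] del: of_real_power)

lemma toeplitz_lincomb:
  assumes f: "f \<in> bergman" and g: "g \<in> bergman"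
  shows "T (\<lambda>z. a * f z + b * g z) = (\<lambda>z. a * T f z + b * T g z)"
proof
  fix z
  show "T (\<lambda>z. a * f z + b * g z) z = a * T f z + b * T g z"
  proof (cases "z \<in> unit_disk")
    case True
    have d: "(deriv ^^ k) (\<lambda>z. a * f z + b * g z) w = a * (deriv ^^ k) f w + b * (deriv ^^ k) g w"
      if w: "w \<in> unit_disk" for w
    proof -
      note hol = bergmanD(1)[OF f] bergmanD(1)[OF g]
      have "(deriv ^^ k) (\<lambda>z. a * f z + b * g z) w
          = (deriv ^^ k) (\<lambda>z. a * f z) w + (deriv ^^ k) (\<lambda>z. b * g z) w"
        using w hol by (intro higher_deriv_add[where S = unit_disk]) (auto intro!: holomorphic_intros)
      then show ?thesis
        using higher_deriv_cmult[OF hol(1) w] higher_deriv_cmult[OF hol(2) w] by simp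
    qed
    have i: "integrable \<mu> (\<lambda>w. (deriv ^^ k) h w * K w z)" if "h \<in> bergman" for h
      by (intro integrable_mult_of_square_integrable deriv_measurable deriv_square_integrable
          K_measurable_left that True)
    have "T (\<lambda>z. a * f z + b * g z) z
        = (LINT w|\<mu>. a * ((deriv ^^ k) f w * K w z) + b * ((deriv ^^ k) g w * K w z))"
      unfolding toeplitz_eq[OF True]
      by (rule Bochner_Integration.integral_cong) (simp_all add: space_\<mu> d algebra_simps)
    also have "\<dots> = a * T f z + b * T g z"
      unfolding toeplitz_eq[OF True] using i[OF f] i[OF g] by simp
    finally show ?thesis .
  qed (simp add: toeplitz_def)
qed

lemma toeplitz_bergman_operator: "bergman_operator T"
  unfolding bergman_operator_def using toeplitz_bergman toeplitz_lincomb by blast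

lemma toeplitz_self_adjoint: "bergman_adjoint T T"
  unfolding bergman_adjoint_def
proof (intro conjI ballI toeplitz_bergman_operator)
  fix f g assume fg: "f \<in> bergman" "g \<in> bergman"
  have "bergman_inner f (T g) = cnj (bergman_inner (T g) f)"
    by (simp add: bergman_inner_cnj)
  then show "bergman_inner (T f) g = bergman_inner f (T g)"
    unfolding toeplitz_inner[OF fg] toeplitz_inner[OF fg(2,1)]
    by (simp add: mult.commute flip: Bochner_Integration.integral_cnj)
qed

lemma toeplitz_abs: "bergman_abs T T"
  unfolding bergman_abs_def
  using toeplitz_bergman_operator toeplitz_self_adjoint toeplitz_inner_self by auto

section \<open>Diagonal sums and the trace\<close>

text \<open>All terms are non-negative, so the computation runs in \<open>ennreal\<close>, where sum
  and integral may be exchanged before convergence is known. After the exchange Parseval removes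
  every trace of the choice of \<open>E\<close>.\<close>

lemma toeplitz_trace_sum:
  assumes E: "bergman_onb E"
  shows "((\<lambda>e. bergman_inner (T e) e) has_sum complex_of_real trace_value) E"
proof -
  have Eb: "e \<in> bergman" if "e \<in> E" for e
    using that E by (auto simp: bergman_onb_def)
  define q where "q = (\<lambda>e. LINT w|\<mu>. (cmod ((deriv ^^ k) e w))\<^sup>2)"
  have "(\<integral>\<^sup>+ e. ennreal (q e) \<partial>count_space E)
      = (\<integral>\<^sup>+ e. (\<integral>\<^sup>+ w. ennreal ((cmod ((deriv ^^ k) e w))\<^sup>2) \<partial>\<mu>) \<partial>count_space E)"
    unfolding q_def
    by (intro nn_integral_cong nn_integral_eq_integral [symmetric] deriv_square_integrable) (auto simp: Eb)
  also have "\<dots> = (\<integral>\<^sup>+ w. (\<integral>\<^sup>+ e. ennreal ((cmod ((deriv ^^ k) e w))\<^sup>2) \<partial>count_space E) \<partial>\<mu>)"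
    using deriv_measurable[OF Eb]
    by (intro nn_integral_count_space_nn_integral [symmetric] onb_countable E) measurable
  also have "\<dots> = (\<integral>\<^sup>+ w. ennreal ((bergman_norm (K w))\<^sup>2) \<partial>\<mu>)"
  proof (rule nn_integral_cong)
    fix w assume "w \<in> space \<mu>"
    then have w: "w \<in> unit_disk" by (simp add: space_\<mu>)
    have "((\<lambda>e. (cmod (bergman_inner (K w) e))\<^sup>2) has_sum (bergman_norm (K w))\<^sup>2) E"
      by (rule onb_Parseval[OF E deriv_kernel_bergman[OF w]])
    \<comment> \<open>Parseval expands \<open>K w\<close>, whereas the reproducing formula has it as
      second argument; the two inner products are conjugate, hence equal in modulus.\<close>
    moreover have "cmod (bergman_inner (K w) e) = cmod ((deriv ^^ k) e w)" if "e \<in> E" for e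
      by (metis reproducing_deriv_kernel[OF Eb[OF that] w] bergman_inner_cnj complex_mod_cnj)
    ultimately have "((\<lambda>e. (cmod ((deriv ^^ k) e w))\<^sup>2) has_sum (bergman_norm (K w))\<^sup>2) E"
      by (simp cong: has_sum_cong)
    then show "(\<integral>\<^sup>+ e. ennreal ((cmod ((deriv ^^ k) e w))\<^sup>2) \<partial>count_space E) = ennreal ((bergman_norm (K w))\<^sup>2)"
      by (subst nn_integral_count_space_eq_iff_has_sum) auto
  qed
  also have "\<dots> = ennreal trace_value"
    unfolding trace_value_def by (intro nn_integral_eq_integral norm_K_integrable) auto
  finally have "(q has_sum trace_value) E"
    by (subst (asm) nn_integral_count_space_eq_iff_has_sum) (auto simp: q_def trace_value_nonneg)
  then have "((\<lambda>e. complex_of_real (q e)) has_sum complex_of_real trace_value) E"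
    by (rule has_sum_of_real)
  then show ?thesis
    by (rule has_sum_cong[THEN iffD1, rotated]) (simp add: q_def toeplitz_inner_self Eb)
qed

lemma toeplitz_trace_class: "bergman_trace_class T"
  unfolding bergman_trace_class_def
  using toeplitz_bergman_operator toeplitz_abs toeplitz_trace_sum has_sum_imp_summable by blast

lemma toeplitz_trace: "bergman_trace T = complex_of_real trace_value"
  unfolding bergman_trace_def
proof (rule the_equality)
  fix t assume "\<forall>E. bergman_onb E \<longrightarrow> ((\<lambda>e. bergman_inner (T e) e) has_sum t) E"
  \<comment> \<open>Uniqueness uses an actual basis: without one, every \<open>t\<close> would
    satisfy the description vacuously.\<close>
  with toeplitz_trace_sum bergman_onb_normalized_monomials show "t = complex_of_real trace_value"
    using has_sum_unique by blast
qed (use toeplitz_trace_sum in blast)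

text \<open>Formulated for every \<open>h\<close> with the prescribed values on the disk, so that it
  covers both ways of writing the function, in \<open>cmod w\<close> and in
  \<open>w * cnj w\<close>.\<close>

lemma integral_wirtinger:
  assumes h: "\<And>w. w \<in> unit_disk \<Longrightarrow> h w = 1 / (1 - w * cnj w)\<^sup>2"
  shows "integrable \<mu> ((wirtinger ^^ k) ((wirtinger_bar ^^ k) h))"
    "(LINT w|\<mu>. (wirtinger ^^ k) ((wirtinger_bar ^^ k) h) w) = complex_of_real trace_value"
proof -
  have eq: "(wirtinger ^^ k) ((wirtinger_bar ^^ k) h) w = complex_of_real ((bergman_norm (K w))\<^sup>2)"
    if "w \<in> space \<mu>" for w
    using deriv_kernel_norm_kernel_comb[of k] h that unfolding space_\<mu> by metis
  have "integrable \<mu> (\<lambda>w. complex_of_real ((bergman_norm (K w))\<^sup>2))"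
    using norm_K_integrable by (rule integrable_of_real)
  then show "integrable \<mu> ((wirtinger ^^ k) ((wirtinger_bar ^^ k) h))"
    by (rule Bochner_Integration.integrable_cong[THEN iffD1, rotated 2]) (simp_all only: eq)
  have "(LINT w|\<mu>. (wirtinger ^^ k) ((wirtinger_bar ^^ k) h) w)
      = (LINT w|\<mu>. complex_of_real ((bergman_norm (K w))\<^sup>2))"
    by (rule Bochner_Integration.integral_cong) (simp_all only: eq)
  then show "(LINT w|\<mu>. (wirtinger ^^ k) ((wirtinger_bar ^^ k) h) w) = complex_of_real trace_value"
    by (simp only: integral_complex_of_real trace_value_def)
qed

end

theorem theorem3p2:
  fixes k :: nat and \<mu> :: "complex measure"
  assumes "k \<ge> 1"
    and "regular_on_disk \<mu>"
    and "carleson k \<mu>"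
    and "(\<integral>\<^sup>+ w. ennreal ((1 - (cmod w)\<^sup>2) powr (- 2 - 2 * real k)) \<partial>\<mu>) < \<infinity>"
  shows "bergman_trace_class (toeplitz k k \<mu>)
    \<and> bergman_trace (toeplitz k k \<mu>)
        = distribution_pairing k k \<mu> (\<lambda>w. 1 / complex_of_real ((1 - (cmod w)\<^sup>2)\<^sup>2))
    \<and> integrable \<mu> ((wirtinger ^^ k) ((wirtinger_bar ^^ k) (\<lambda>w. 1 / (1 - w * cnj w)\<^sup>2)))
    \<and> bergman_trace (toeplitz k k \<mu>)
        = (LINT w|\<mu>. (wirtinger ^^ k) ((wirtinger_bar ^^ k) (\<lambda>w. 1 / (1 - w * cnj w)\<^sup>2)) w)"
proof -
  interpret trace_measure k \<mu>
    using assms by unfold_locales (simp_all add: regular_on_disk_def)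
  have "1 / complex_of_real ((1 - (cmod w)\<^sup>2)\<^sup>2) = 1 / (1 - w * cnj w)\<^sup>2" for w
    by (simp add: complex_norm_square [symmetric])
  then have "distribution_pairing k k \<mu> (\<lambda>w. 1 / complex_of_real ((1 - (cmod w)\<^sup>2)\<^sup>2))
      = complex_of_real trace_value"
    \<comment> \<open>The sign is an even power of -1, namely of exponent
      \<open>k + k\<close>.\<close>
    unfolding distribution_pairing_def by (subst integral_wirtinger) (auto simp flip: mult_2)
  then show ?thesis
    using toeplitz_trace_class toeplitz_trace integral_wirtinger[of "\<lambda>w. 1 / (1 - w * cnj w)\<^sup>2"]
    by simp
qed

end
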